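(* Let $n\ge 2$. The totally nonnegative polynomial part of $U$ decomposes as a disjoint union $$U_{\geq 0}^{\mathrm{pol}}=\bigsqcup_{w\in\tilde W}E_w .$$
   Context: Elements of $GL_n(\mathbb R((t)))$ are identified with their unfoldings. The unfolding of $(a_{ij}(t))$ is the $\mathbb Z\times\mathbb Z$ real matrix $X=(x_{i,j})$ with $x_{i+n,j+n}=x_{i,j}$ and $a_{ij}(t)=\sum_{k}x_{i,j+kn}t^k$; all minors are minors of this infinite matrix. $U$ denotes the group of upper-triangular unipotent elements of $GL_n(\mathbb R((t)))$. $U_{\ge0}$ is the set of $X\in U$ all of whose finite minors are nonnegative. $U^{\mathrm{pol}}_{\ge 0}$ is the set of $X\in U_{\ge 0}$ such that the folded entries of both $X$ and $X^{-1}$ are Laurent polynomials. For $i\in\mathbb Z/n\mathbb Z$ and $a\in\mathbb R$, the Chevalley generator $e_i(a)$ is the element of $U$ whose unfolding equals the identity except for entries $a$ in positions $(kn+i,kn+i+1)$, for all $k\in\mathbb Z$. $\tilde W$ is the affine symmetric group with simple generators $s_i$, $i\in\mathbb Z/n\mathbb Z$. For $w\in\tilde W$ with a reduced word $i_1\cdots i_\ell$, set $E_w=\{e_{i_1}(a_1)\cdots e_{i_\ell}(a_\ell)\mid a_1,\dots,a_\ell>0\}$. This set does not depend on the choice of reduced word. *)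

theory Defs
  imports
    "HOL-Computational_Algebra.Formal_Laurent_Series"
    "HOL-Number_Theory.Cong"
    "HOL-Library.Disjoint_Sets"
    "Jordan_Normal_Form.Determinant"
begin

section \<open>The formal loop group and unfoldings\<close>

definition loop_GL :: "nat \<Rightarrow> real fls mat set" where
  "loop_GL n = {A \<in> carrier_mat n n. invertible_mat A}"

text \<open>
  The matrix entry $a_{ij}(t)$ with $1 \le i, j \le n$ is stored at the 0-based position
  $(i - 1, j - 1)$, hence the shifts by one: for $1 \le i, j \le n$ the value of the unfolding
  at $(i, j + kn)$ is the coefficient of $t^k$ in $a_{ij}(t)$, and the unfolding is invariant
  under $(i, j) \mapsto (i + n, j + n)$.
\<close>

definition unfold_mat :: "nat \<Rightarrow> real fls mat \<Rightarrow> int \<Rightarrow> int \<Rightarrow> real" where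
  "unfold_mat n A i j =
     fls_nth (A $$ (nat ((i - 1) mod int n), nat ((j - 1) mod int n)))
             ((j - 1) div int n - (i - 1) div int n)"

definition fold_mat :: "nat \<Rightarrow> (int \<Rightarrow> int \<Rightarrow> real) \<Rightarrow> real fls mat" where
  "fold_mat n x = mat n n (\<lambda>(r, c). Abs_fls (\<lambda>k. x (int r + 1) (int c + 1 + k * int n)))"

section \<open>Total nonnegativity\<close>

definition loop_U :: "nat \<Rightarrow> real fls mat set" where
  "loop_U n = {A \<in> loop_GL n.
     (\<forall>i j. j < i \<longrightarrow> unfold_mat n A i j = 0) \<and> (\<forall>i. unfold_mat n A i i = 1)}"

definition finite_minor :: "(int \<Rightarrow> int \<Rightarrow> real) \<Rightarrow> nat \<Rightarrow> (nat \<Rightarrow> int) \<Rightarrow> (nat \<Rightarrow> int) \<Rightarrow> real" where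
  "finite_minor x k r c = det (mat k k (\<lambda>(p, q). x (r p) (c q)))"

definition loop_U_nonneg :: "nat \<Rightarrow> real fls mat set" where
  "loop_U_nonneg n = {A \<in> loop_U n.
     \<forall>k r c. strict_mono_on {..<k} r \<longrightarrow> strict_mono_on {..<k} c \<longrightarrow>
       0 \<le> finite_minor (unfold_mat n A) k r c}"

definition laurent_polynomial :: "real fls \<Rightarrow> bool" where
  "laurent_polynomial f \<longleftrightarrow> finite {k. fls_nth f k \<noteq> 0}"

definition loop_U_nonneg_pol :: "nat \<Rightarrow> real fls mat set" where
  "loop_U_nonneg_pol n = {A \<in> loop_U_nonneg n.
     (\<forall>f \<in> elements_mat A. laurent_polynomial f) \<and>
     (\<exists>B. inverts_mat A B \<and> inverts_mat B A \<and> (\<forall>f \<in> elements_mat B. laurent_polynomial f))}"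

section \<open>Chevalley generators\<close>

text \<open>The index \<open>i\<close> only matters modulo \<open>n\<close>.\<close>

definition chevalley_unfolded :: "nat \<Rightarrow> int \<Rightarrow> real \<Rightarrow> int \<Rightarrow> int \<Rightarrow> real" where
  "chevalley_unfolded n i a p q =
     (if p = q then 1 else if [p = i] (mod int n) \<and> q = p + 1 then a else 0)"

definition chevalley :: "nat \<Rightarrow> int \<Rightarrow> real \<Rightarrow> real fls mat" where
  "chevalley n i a = fold_mat n (chevalley_unfolded n i a)"

lemma unfold_chevalley:
  assumes "n \<ge> 2"
  shows "unfold_mat n (chevalley n i a) = chevalley_unfolded n i a"
proof (intro ext)
  fix p q :: int
  define r where "r = (p - 1) mod int n"
  define d where "d = (p - 1) div int n"
  define c where "c = (q - 1) mod int n"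
  define e where "e = (q - 1) div int n"
  have p: "p = r + 1 + d * int n" and q: "q = c + 1 + e * int n"
    unfolding r_def d_def c_def e_def by (simp_all add: algebra_simps)
  have r: "0 \<le> r" "r < int n" and c: "0 \<le> c" "c < int n"
    using assms unfolding r_def c_def by simp_all
  have shift: "chevalley_unfolded n i a (x + k * int n) (y + k * int n) =
      chevalley_unfolded n i a x y" for x y k
    by (simp add: chevalley_unfolded_def cong_def)
  have "chevalley_unfolded n i a (r + 1) (c + 1 + k * int n) = 0" if "k < - int n" for k
  proof -
    have "k * int n \<le> (- int n) * int n"
      using that by (intro mult_right_mono) auto
    also have "\<dots> \<le> - int n"
      using assms by simp
    also have "\<dots> < r - c"
      using r c by linarith
    finally show ?thesis
      by (auto simp: chevalley_unfolded_def)
  qed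
  then have "fls_nth (Abs_fls (\<lambda>k. chevalley_unfolded n i a (r + 1) (c + 1 + k * int n))) (e - d) =
      chevalley_unfolded n i a (r + 1) (c + 1 + (e - d) * int n)"
    by (intro nth_Abs_fls_lower_bound) auto
  also have "\<dots> = chevalley_unfolded n i a p q"
    using shift[of "r + 1" d "c + 1 + (e - d) * int n"] p q by (simp add: algebra_simps)
  finally show "unfold_mat n (chevalley n i a) p q = chevalley_unfolded n i a p q"
    using r c unfolding unfold_mat_def r_def[symmetric] d_def[symmetric] c_def[symmetric]
      e_def[symmetric] by (simp add: chevalley_def fold_mat_def nat_less_iff)
qed

section \<open>The affine symmetric group\<close>

definition affine_sym :: "nat \<Rightarrow> (int \<Rightarrow> int) set" where
  "affine_sym n = {w. bij w \<and> (\<forall>i. w (i + int n) = w i + int n) \<and>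
                      (\<Sum>i = 1..int n. w i) = (\<Sum>i = 1..int n. i)}"

definition affine_s :: "nat \<Rightarrow> int \<Rightarrow> int \<Rightarrow> int" where
  "affine_s n i k =
     (if [k = i] (mod int n) then k + 1 else if [k = i + 1] (mod int n) then k - 1 else k)"

text \<open>Words are lists over the representatives $0, \dots, n - 1$ of $\mathbb{Z}/n\mathbb{Z}$.\<close>

definition words :: "nat \<Rightarrow> int list set" where
  "words n = lists {0..<int n}"

definition word_perm :: "nat \<Rightarrow> int list \<Rightarrow> int \<Rightarrow> int" where
  "word_perm n ws = foldr (\<lambda>i w. affine_s n i \<circ> w) ws id"

definition reduced_word :: "nat \<Rightarrow> (int \<Rightarrow> int) \<Rightarrow> int list \<Rightarrow> bool" where
  "reduced_word n w ws \<longleftrightarrow> ws \<in> words n \<and> word_perm n ws = w \<and>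
     (\<forall>js \<in> words n. word_perm n js = w \<longrightarrow> length ws \<le> length js)"

section \<open>The cells\<close>

definition chevalley_prod :: "nat \<Rightarrow> int list \<Rightarrow> real list \<Rightarrow> real fls mat" where
  "chevalley_prod n ws as = foldr (\<lambda>(i, a) A. chevalley n i a * A) (zip ws as) (1\<^sub>m n)"

definition E_word :: "nat \<Rightarrow> int list \<Rightarrow> real fls mat set" where
  "E_word n ws = {chevalley_prod n ws as | as. length as = length ws \<and> (\<forall>a \<in> set as. 0 < a)}"

text \<open>
  The set \<open>E_word n ws\<close> is the same for all reduced words of a given \<open>w\<close>, so the choice below is
  immaterial.
\<close>

definition E_cell :: "nat \<Rightarrow> (int \<Rightarrow> int) \<Rightarrow> real fls mat set" where
  "E_cell n w = E_word n (SOME ws. reduced_word n w ws)"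

end

theory Submission
  imports Defs
begin

text \<open>
  Left multiplication by \<open>e\<^sub>i(a)\<close> adds \<open>a\<close> times row \<open>p + 1\<close> to row \<open>p\<close> of the unfolding for all
  \<open>p\<close> congruent to \<open>i\<close>; for \<open>a > 0\<close> this preserves total nonnegativity.  Conversely, in a totally
  nonnegative polynomial matrix the last nonzero columns of the rows are weakly increasing.  If two
  neighbouring rows end in the same column, then at the first row \<open>i\<close> of such a block the last entry
  can be eliminated with the next row; this Whitney-type reduction preserves total nonnegativity by
  a three-term determinant identity.  Otherwise all rows have the same length, and polynomiality of
  the inverse forces the matrix to be the identity.  Hence every element is a product of Chevalley
  generators with positive parameters.  The braid relations and the exchange property make the
  word reduced and arbitrary among the reduced words.  Finally \<open>w\<close> is recovered from the matrix: the set
  of positions of last nonzero entries of vectors in the span of the rows up to \<open>p\<close> is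
  the image of \<open>{..p}\<close> under the inverse of \<open>w\<close>.
\<close>

section \<open>Determinants of arrays\<close>

text \<open>The obstacle is that the unfolding is infinite in both directions and a generator
  changes infinitely many rows at once. Two facts help: a finite minor meets only finitely many
  changed rows, and since \<open>n \<ge> 2\<close> no two changed rows are neighbours, so they can
  be treated one at a time in any order. The first row of a block is the right place to eliminate
  because the rows above it end strictly further left, so the column of the eliminated entry is zero
  above it. The bidiagonal matrix of ones shows why the inverse has to be polynomial: it is totally
  nonnegative, no two of its rows end in the same column, and it is not a product of generators.
  Permutations are studied through their inverses because row operations act on the left: a simple
  reflection then exchanges adjacent positions of the inverse.\<close>

definition array_det :: "nat \<Rightarrow> (nat \<Rightarrow> nat \<Rightarrow> real) \<Rightarrow> real" where
  "array_det k M = det (mat k k (\<lambda>(p, q). M p q))"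

lemma array_det_cong:
  assumes "\<And>p q. p < k \<Longrightarrow> q < k \<Longrightarrow> M p q = N p q"
  shows "array_det k M = array_det k N"
  unfolding array_det_def by (rule arg_cong[where f = det]) (auto intro!: eq_matI simp: assms)

definition array_cof :: "nat \<Rightarrow> (nat \<Rightarrow> nat \<Rightarrow> real) \<Rightarrow> nat \<Rightarrow> nat \<Rightarrow> real" where
  "array_cof k M p q =
     (-1) ^ (p + q) * array_det (k - 1) (\<lambda>a b. M (insert_index p a) (insert_index q b))"

lemma cofactor_array:
  assumes "p < k" "q < k"
  shows "cofactor (mat k k (\<lambda>(p, q). M p q)) p q = array_cof k M p q"
proof -
  have "mat_delete (mat k k (\<lambda>(p, q). M p q)) p q =
      mat (k - 1) (k - 1) (\<lambda>(a, b). M (insert_index p a) (insert_index q b))"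
    using assms by (intro eq_matI) (auto simp: mat_delete_def insert_index_def)
  then show ?thesis
    by (simp add: cofactor_def array_cof_def array_det_def)
qed

lemma array_det_expand_row:
  assumes "p < k"
  shows "array_det k M = (\<Sum>q<k. M p q * array_cof k M p q)"
  unfolding array_det_def using assms
  by (subst laplace_expansion_row[of _ k p]) (auto simp: cofactor_array intro!: sum.cong)

lemma array_det_expand_col:
  assumes "q < k"
  shows "array_det k M = (\<Sum>p<k. M p q * array_cof k M p q)"
  unfolding array_det_def using assms
  by (subst laplace_expansion_column[of _ k q]) (auto simp: cofactor_array intro!: sum.cong)

text \<open>\<open>insert_index p\<close> never takes the value \<open>p\<close>, so the cofactors
  along row \<open>p\<close> do not see that row. Expansion along row \<open>p\<close> therefore
  makes the determinant linear in that row with fixed coefficients.\<close>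

lemma array_cof_upd: "array_cof k (M(p := u)) p q = array_cof k M p q"
  unfolding array_cof_def
  by (intro arg_cong2[where f = "(*)"] array_det_cong) (auto simp: insert_index_def)

lemma array_det_upd:
  assumes "p < k"
  shows "array_det k (M(p := u)) = (\<Sum>q<k. u q * array_cof k M p q)"
  using array_det_expand_row[OF assms, of "M(p := u)"] by (simp add: array_cof_upd)

lemma array_det_linear:
  assumes "p < k"
  shows "array_det k (M(p := \<lambda>q. u q + a * v q)) =
    array_det k (M(p := u)) + a * array_det k (M(p := v))"
  using assms by (simp add: array_det_upd sum_distrib_left sum.distrib algebra_simps)

lemma array_det_zero_col:
  assumes "q < k" "\<And>p. p < k \<Longrightarrow> M p q = 0"
  shows "array_det k M = 0"
  by (subst array_det_expand_col[OF assms(1)]) (simp add: assms(2))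

lemma array_det_identical_rows:
  assumes "i \<noteq> j" "i < k" "j < k" "\<And>q. q < k \<Longrightarrow> M i q = M j q"
  shows "array_det k M = 0"
  unfolding array_det_def
  by (rule det_identical_rows[of _ k i j]) (use assms in \<open>auto intro!: eq_vecI\<close>)

lemma array_det_swap_rows:
  assumes "i \<noteq> j" "i < k" "j < k"
  shows "array_det k (M(i := M j, j := M i)) = - array_det k M"
proof -
  have "mat k k (\<lambda>(p, q). (M(i := M j, j := M i)) p q) = swaprows i j (mat k k (\<lambda>(p, q). M p q))"
    using assms by (intro eq_matI) auto
  then show ?thesis
    unfolding array_det_def using det_swaprows[OF assms(2,3,1), of "mat k k (\<lambda>(p, q). M p q)"]
    by (simp del: fun_upd_apply)
qed

text \<open>Expanding each \<open>array_det k (N(q := x))\<close> along row \<open>q\<close> turns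
  the right side into entry \<open>c\<close> of \<open>x\<close> times the adjugate of
  \<open>N\<close> times \<open>N\<close>. There is no division, so \<open>N\<close> may be
  singular.\<close>

lemma array_det_cramer:
  assumes "c < k"
  shows "array_det k N * x c = (\<Sum>q<k. array_det k (N(q := x)) * N q c)"
proof -
  let ?A = "mat k k (\<lambda>(p, q). N p q)"
  have orth: "(\<Sum>q<k. array_cof k N q b * N q c) = (if b = c then array_det k N else 0)"
    if "b < k" for b
  proof -
    have "(adj_mat ?A * ?A) $$ (b, c) = (\<Sum>q<k. array_cof k N q b * N q c)"
      using that assms
      by (auto simp: adj_mat_def scalar_prod_def cofactor_array lessThan_atLeast0 intro!: sum.cong)
    then show ?thesis
      using adj_mat(3)[of ?A k] that assms by (auto simp: array_det_def split: if_splits)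
  qed
  have "(\<Sum>q<k. array_det k (N(q := x)) * N q c) =
      (\<Sum>q<k. \<Sum>b<k. x b * (array_cof k N q b * N q c))"
    by (auto simp: array_det_upd sum_distrib_right mult.assoc intro!: sum.cong)
  also have "\<dots> = (\<Sum>b<k. x b * (\<Sum>q<k. array_cof k N q b * N q c))"
    by (subst sum.swap) (simp add: sum_distrib_left)
  also have "\<dots> = (\<Sum>b<k. if b = c then x c * array_det k N else 0)"
    by (intro sum.cong) (auto simp: orth)
  also have "\<dots> = array_det k N * x c"
    using assms by simp
  finally show ?thesis ..
qed

text \<open>
  Obtained by applying the linear functional \<open>\<phi>\<close> to Cramer's rule: all rows of \<open>N\<close>
  except those at \<open>p\<close> and \<open>p + 1\<close> are annihilated by \<open>\<phi>\<close>.
\<close>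

lemma array_det_three_term:
  fixes N :: "nat \<Rightarrow> nat \<Rightarrow> real" and j :: nat
  assumes "Suc p < k"
  defines "\<phi> \<equiv> \<lambda>y. array_det (k - 1)
    (\<lambda>a b. ((\<lambda>a. N (insert_index (Suc p) a))(p := y)) a (insert_index j b))"
  shows "array_det k N * \<phi> x =
    array_det k (N(p := x)) * \<phi> (N p) + array_det k (N(Suc p := x)) * \<phi> (N (Suc p))"
proof -
  define M where "M = (\<lambda>a b. N (insert_index (Suc p) a) (insert_index j b))"
  have phi: "\<phi> y = (\<Sum>b<k - 1. y (insert_index j b) * array_cof (k - 1) M p b)" for y
  proof -
    have "\<phi> y = array_det (k - 1) (M(p := \<lambda>b. y (insert_index j b)))"
      unfolding \<phi>_def M_def by (rule array_det_cong) auto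
    then show ?thesis
      using assms(1) by (simp add: array_det_upd)
  qed
  have zero: "\<phi> (N q) = 0" if "q < k" "q \<noteq> p" "q \<noteq> Suc p" for q
  proof -
    \<comment> \<open>The position of row \<open>q\<close> once row \<open>p + 1\<close> is deleted.
      It differs from \<open>p\<close>, so row \<open>q\<close> occurs twice when it is also put in
      place \<open>p\<close>.\<close>
    define a where "a = (if q < p then q else q - 1)"
    have "insert_index (Suc p) a = q" "a < k - 1" "a \<noteq> p"
      using that assms(1) by (auto simp: a_def insert_index_def)
    then show ?thesis
      unfolding \<phi>_def using assms(1)
      by (intro array_det_identical_rows[of a p]) auto
  qed
  have "array_det k N * \<phi> x =
      (\<Sum>b<k - 1. array_det k N * x (insert_index j b) * array_cof (k - 1) M p b)"
    by (simp add: phi sum_distrib_left mult.assoc)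
  also have "\<dots> = (\<Sum>b<k - 1. \<Sum>q<k. array_det k (N(q := x)) *
      (N q (insert_index j b) * array_cof (k - 1) M p b))"
  proof (intro sum.cong refl)
    fix b assume "b \<in> {..<k - 1}"
    then have idx: "insert_index j b < k"
      by (auto simp: insert_index_def)
    show "array_det k N * x (insert_index j b) * array_cof (k - 1) M p b =
        (\<Sum>q<k. array_det k (N(q := x)) * (N q (insert_index j b) * array_cof (k - 1) M p b))"
      by (simp add: array_det_cramer[OF idx, of N x] sum_distrib_right mult.assoc)
  qed
  also have "\<dots> = (\<Sum>q<k. array_det k (N(q := x)) * \<phi> (N q))"
    by (subst sum.swap) (simp add: phi sum_distrib_left)
  also have "\<dots> = (\<Sum>q\<in>{p, Suc p}. array_det k (N(q := x)) * \<phi> (N q))"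
    using assms(1) zero by (intro sum.mono_neutral_right) auto
  finally show ?thesis
    by simp
qed

section \<open>Row operations on totally nonnegative matrices\<close>

definition tnn :: "(int \<Rightarrow> int \<Rightarrow> real) \<Rightarrow> bool" where
  "tnn x \<longleftrightarrow> (\<forall>k r c. strict_mono_on {..<k} r \<longrightarrow> strict_mono_on {..<k} c \<longrightarrow>
     0 \<le> finite_minor x k r c)"

lemma tnnD:
  "tnn x \<Longrightarrow> strict_mono_on {..<k} r \<Longrightarrow> strict_mono_on {..<k} c \<Longrightarrow> 0 \<le> finite_minor x k r c"
  by (auto simp: tnn_def)

lemma finite_minor_array: "finite_minor x k r c = array_det k (\<lambda>p q. x (r p) (c q))"
  by (simp add: finite_minor_def array_det_def)

lemma finite_minor_cong:
  assumes "\<And>p q. p < k \<Longrightarrow> q < k \<Longrightarrow> x (r p) (c q) = y (r' p) (c' q)"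
  shows "finite_minor x k r c = finite_minor y k r' c'"
  unfolding finite_minor_array by (rule array_det_cong) (rule assms)

lemma strict_mono_on_insert_index:
  assumes "strict_mono_on {..<k} (r :: nat \<Rightarrow> int)"
  shows "strict_mono_on {..<k - 1} (\<lambda>a. r (insert_index p a))"
proof (rule strict_mono_onI)
  fix a b assume "a \<in> {..<k - 1}" "b \<in> {..<k - 1}" "a < b"
  then have "insert_index p a < insert_index p b" "insert_index p b < k"
    by (auto simp: insert_index_def)
  then show "r (insert_index p a) < r (insert_index p b)"
    using assms strict_mono_onD[of "{..<k}" r "insert_index p a" "insert_index p b"] by auto
qed

lemma strict_mono_on_upd_next:
  assumes "strict_mono_on {..<k} (r :: nat \<Rightarrow> int)" "r p = i" "p < k"
    and "Suc p < k \<Longrightarrow> i + 1 < r (Suc p)"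
  shows "strict_mono_on {..<k} (r(p := i + 1))"
proof (rule strict_mono_onI)
  fix a b assume ab: "a \<in> {..<k}" "b \<in> {..<k}" "a < b"
  have r: "r a < r b"
    using assms(1) ab by (intro strict_mono_onD[of "{..<k}" r])
  have "r (Suc p) \<le> r b" if "a = p"
  proof (cases "b = Suc p")
    case False
    then show ?thesis
      using assms(1) ab that strict_mono_onD[of "{..<k}" r "Suc p" b] by auto
  qed simp
  then show "(r(p := i + 1)) a < (r(p := i + 1)) b"
    using assms ab r by auto
qed

text \<open>
  Induction on the number of rows below \<open>i\<close>; the three-term relation removes the first of them.
\<close>

lemma minor_ratio_bound:
  assumes tnn: "tnn x" and pos: "x i m > 0" "x (i + 1) m > 0"
    and right: "\<And>p q. p \<le> i + 1 \<Longrightarrow> m < q \<Longrightarrow> x p q = 0"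
    and above: "\<And>p. p < i \<Longrightarrow> x p m = 0"
    and "strict_mono_on {..<k} r" "strict_mono_on {..<k} c" "p < k" "r p = i"
    and "Suc p < k \<Longrightarrow> i + 1 < r (Suc p)"
  shows "x i m * finite_minor x k (r(p := i + 1)) c \<le> x (i + 1) m * finite_minor x k r c"
  using assms(6-)
proof (induction "k - Suc p" arbitrary: k r c)
  case 0
  then have k: "k = Suc p"
    by simp
  have rows: "r a < i" if "a < p" for a
    using 0 k that strict_mono_onD[of "{..<k}" r a p] by auto
  let ?r = "r(p := i + 1)"
  \<comment> \<open>Here row \<open>i\<close> is the last one. If the last column lies beyond
    \<open>m\<close>, it is zero in both minors; if it is \<open>m\<close>, both minors are
    multiples of the same cofactor; if it lies before \<open>m\<close>, the minor bordered by row
    \<open>i + 1\<close> and column \<open>m\<close> is nonnegative, and its expansion along column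
    \<open>m\<close> is the claim.\<close>
  consider "c p > m" | "c p = m" | "c p < m"
    by linarith
  then show ?case
  proof cases
    case 1
    have "x (r a) (c p) = 0" "x (?r a) (c p) = 0" if "a < k" for a
      using that k 1 rows[of a] 0 by (cases "a = p"; auto intro!: right)+
    then have "finite_minor x k r c = 0" "finite_minor x k ?r c = 0"
      unfolding finite_minor_array using k by (intro array_det_zero_col[of p]; simp)+
    then show ?thesis
      by (simp del: fun_upd_apply)
  next
    case 2
    let ?C = "array_cof k (\<lambda>a b. x (r a) (c b)) p p"
    have cof: "array_cof k (\<lambda>a b. x (?r a) (c b)) p p = ?C"
      unfolding array_cof_def
      by (intro arg_cong2[where f = "(*)"] array_det_cong) (auto simp: insert_index_def)
    have zero: "x (r a) (c p) = 0" "x (?r a) (c p) = 0" if "a < k" "a \<noteq> p" for a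
      using that k 2 rows[of a] above by auto
    have "finite_minor x k r c = x i m * ?C"
      unfolding finite_minor_array
      by (subst array_det_expand_col[of p]) (use k zero 0 2 in \<open>auto intro!: sum.neutral\<close>)
    moreover have "finite_minor x k ?r c = x (i + 1) m * ?C"
      unfolding finite_minor_array
      by (subst array_det_expand_col[of p]) (use k zero 0 2 cof in \<open>auto intro!: sum.neutral\<close>)
    ultimately show ?thesis
      by (simp del: fun_upd_apply)
  next
    case 3
    define R where "R = r(k := i + 1)"
    define C where "C = c(k := m)"
    have extend: "strict_mono_on {..<Suc k} (f(k := t))"
      if f: "strict_mono_on {..<k} f" and t: "f p < t" for f :: "nat \<Rightarrow> int" and t
    proof (rule strict_mono_onI)
      fix a b assume ab: "a \<in> {..<Suc k}" "b \<in> {..<Suc k}" "a < b"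
      have "f a < f b" if "b < k"
        using ab that by (intro strict_mono_onD[OF f]) auto
      moreover have "f a \<le> f p"
        using ab k strict_mono_onD[OF f, of a p] by (cases "a = p") auto
      ultimately show "(f(k := t)) a < (f(k := t)) b"
        using ab t by auto
    qed
    have "strict_mono_on {..<Suc k} R" "strict_mono_on {..<Suc k} C"
      unfolding R_def C_def using 0 3 by (auto intro!: extend)
    then have "0 \<le> finite_minor x (Suc k) R C"
      by (rule tnnD[OF tnn])
    also have "\<dots> = (\<Sum>a<Suc k. x (R a) (C k) * array_cof (Suc k) (\<lambda>a b. x (R a) (C b)) a k)"
      unfolding finite_minor_array by (rule array_det_expand_col) simp
    also have "\<dots> = (\<Sum>a\<in>{p, k}. x (R a) (C k) * array_cof (Suc k) (\<lambda>a b. x (R a) (C b)) a k)"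
      using k above rows by (intro sum.mono_neutral_right) (auto simp: R_def C_def)
    also have "\<dots> = x i m * array_cof (Suc k) (\<lambda>a b. x (R a) (C b)) p k +
        x (i + 1) m * array_cof (Suc k) (\<lambda>a b. x (R a) (C b)) k k"
      using k 0 by (simp add: R_def C_def)
    also have "array_cof (Suc k) (\<lambda>a b. x (R a) (C b)) p k = - finite_minor x k ?r c"
      unfolding array_cof_def finite_minor_array using k
      by (auto simp: R_def C_def insert_index_def intro!: array_det_cong)
    also have "array_cof (Suc k) (\<lambda>a b. x (R a) (C b)) k k = finite_minor x k r c"
      unfolding array_cof_def finite_minor_array using k
      by (auto simp: R_def C_def insert_index_def intro!: array_det_cong)
    finally show ?thesis
      by simp
  qed
next
  case (Suc d)
  have p: "Suc p < k" and next_row: "i + 1 < r (Suc p)"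
    using Suc by auto
  let ?r = "r(p := i + 1)"
  have mono: "strict_mono_on {..<k} ?r"
    using Suc.prems by (intro strict_mono_on_upd_next) auto
  define N where "N = (\<lambda>a b. x (?r a) (c b))"
  have D: "finite_minor x k ?r c = array_det k N"
    by (simp add: finite_minor_array N_def)
  show ?case
  proof (cases "array_det k N = 0")
    case True
    then show ?thesis
      using D tnnD[OF tnn Suc.prems(1,2)] pos by simp
  next
    case False
    \<comment> \<open>Deleting this column together with row \<open>p + 1\<close> makes
      \<open>\<phi> (N p)\<close> nonzero, hence positive, so that it can be cancelled at the
      end.\<close>
    then obtain j where j: "j < k" "array_cof k N (Suc p) j \<noteq> 0"
      using array_det_expand_row[OF p, of N]
          by (metis (no_types, lifting) lessThan_iff mult_zero_right sum.neutral)
    define c' where "c' = (\<lambda>b. c (insert_index j b))"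
    define r' where "r' = (\<lambda>a. r (insert_index (Suc p) a))"
    define \<phi> where "\<phi> = (\<lambda>y. array_det (k - 1)
      (\<lambda>a b. ((\<lambda>a. N (insert_index (Suc p) a))(p := y)) a (insert_index j b)))"
    have mono': "strict_mono_on {..<k - 1} r'" "strict_mono_on {..<k - 1} c'"
        "strict_mono_on {..<k - 1} (\<lambda>a. r (insert_index p a))"
      unfolding r'_def c'_def by (rule strict_mono_on_insert_index, fact)+
    have r'p: "r' p = i" "p < k - 1"
      using Suc.prems p by (auto simp: r'_def)
    have r'n: "i + 1 < r' (Suc p)" if "Suc p < k - 1"
    proof -
      have "Suc (Suc p) < k"
        using that by simp
      then show ?thesis
        using next_row Suc.prems(1) strict_mono_onD[of "{..<k}" r "Suc p" "Suc (Suc p)"]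
        by (simp add: r'_def)
    qed
    have three: "array_det k N * \<phi> (\<lambda>b. x i (c b)) =
        array_det k (N(p := \<lambda>b. x i (c b))) * \<phi> (N p) +
        array_det k (N(Suc p := \<lambda>b. x i (c b))) * \<phi> (N (Suc p))"
      unfolding \<phi>_def by (rule array_det_three_term[OF p])
    have phi_i: "\<phi> (\<lambda>b. x i (c b)) = finite_minor x (k - 1) r' c'"
      unfolding \<phi>_def finite_minor_array N_def using r'p
      by (intro array_det_cong) (auto simp: r'_def c'_def insert_index_def)
    have phi_p: "\<phi> (N p) = finite_minor x (k - 1) (r'(p := i + 1)) c'"
      unfolding \<phi>_def finite_minor_array N_def
      by (intro array_det_cong) (auto simp: r'_def c'_def insert_index_def)
    have phi_Suc: "\<phi> (N (Suc p)) = finite_minor x (k - 1) (\<lambda>a. r (insert_index p a)) c'"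
      unfolding \<phi>_def finite_minor_array N_def
      by (intro array_det_cong) (auto simp: c'_def insert_index_def)
    have E: "array_det k (N(p := \<lambda>b. x i (c b))) = finite_minor x k r c"
      unfolding finite_minor_array N_def using Suc.prems
      by (intro array_det_cong) auto
    have T: "array_det k (N(Suc p := \<lambda>b. x i (c b))) = - finite_minor x k (r(Suc p := i + 1)) c"
    proof -
      let ?M = "\<lambda>a b. x ((r(Suc p := i + 1)) a) (c b)"
      \<comment> \<open>Row \<open>i\<close> now stands below row \<open>i + 1\<close>. Exchanging
        them restores the increasing order and yields the sign that makes the last term of the
        three-term relation nonpositive.\<close>
      have "array_det k (N(Suc p := \<lambda>b. x i (c b))) = array_det k (?M(p := ?M (Suc p), Suc p := ?M p))"
        using Suc.prems by (intro array_det_cong) (auto simp: N_def)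
      then show ?thesis
        using p by (simp add: finite_minor_array array_det_swap_rows[of p "Suc p" k ?M] del: fun_upd_apply)
    qed
    have "strict_mono_on {..<k} (r(Suc p := i + 1))"
    proof (rule strict_mono_onI)
      fix a b assume ab: "a \<in> {..<k}" "b \<in> {..<k}" "a < b"
      have "r a < r b"
        using Suc.prems(1) ab by (intro strict_mono_onD[of "{..<k}" r])
      moreover have "r a \<le> i" if "b = Suc p"
        using Suc.prems ab that strict_mono_onD[of "{..<k}" r a p] by (cases "a = p") auto
      ultimately show "(r(Suc p := i + 1)) a < (r(Suc p := i + 1)) b"
        using next_row by auto
    qed
    then have T': "array_det k (N(Suc p := \<lambda>b. x i (c b))) * \<phi> (N (Suc p)) \<le> 0"
      unfolding T phi_Suc using tnnD[OF tnn _ Suc.prems(2)] tnnD[OF tnn mono'(3,2)]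
      by (simp add: mult_nonneg_nonneg)
    have DF: "array_det k N * finite_minor x (k - 1) r' c' \<le> finite_minor x k r c * \<phi> (N p)"
      using three T' by (simp add: phi_i E)
    have "x i m * finite_minor x (k - 1) (r'(p := i + 1)) c' \<le>
        x (i + 1) m * finite_minor x (k - 1) r' c'"
      using Suc.hyps(2) mono' r'p r'n by (intro Suc.hyps(1)) auto
    then have IH: "x i m * \<phi> (N p) \<le> x (i + 1) m * finite_minor x (k - 1) r' c'"
      by (simp add: phi_p)
    have "\<phi> (N p) \<noteq> 0"
    proof -
      have "\<phi> (N p) = array_det (k - 1) (\<lambda>a b. N (insert_index (Suc p) a) (insert_index j b))"
        unfolding \<phi>_def by (intro array_det_cong) auto
      then show ?thesis
        using j(2) by (auto simp: array_cof_def)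
    qed
    moreover have "\<phi> (N p) \<ge> 0"
      unfolding phi_p using r'p r'n mono'
      by (intro tnnD[OF tnn] strict_mono_on_upd_next) auto
    ultimately have G: "\<phi> (N p) > 0"
      by simp
    have D0: "array_det k N \<ge> 0"
      using D tnnD[OF tnn mono Suc.prems(2)] by simp
    \<comment> \<open>\<open>IH\<close> bounds the ratio of the two minors after row
      \<open>p + 1\<close> is removed, and \<open>DF\<close> compares that ratio with the present
      one; both are used in multiplied-out form.\<close>
    have "(x i m * array_det k N) * \<phi> (N p) = array_det k N * (x i m * \<phi> (N p))"
      by (simp add: mult_ac)
    also have "\<dots> \<le> array_det k N * (x (i + 1) m * finite_minor x (k - 1) r' c')"
      using IH D0 by (rule mult_left_mono)
    also have "\<dots> = x (i + 1) m * (array_det k N * finite_minor x (k - 1) r' c')"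
      by (simp add: mult_ac)
    also have "\<dots> \<le> x (i + 1) m * (finite_minor x k r c * \<phi> (N p))"
      using DF pos(2) by (intro mult_left_mono) auto
    finally show ?thesis
      using G D by (simp add: mult.assoc[symmetric])
  qed
qed

definition add_row :: "(int \<Rightarrow> int \<Rightarrow> real) \<Rightarrow> int \<Rightarrow> real \<Rightarrow> int \<Rightarrow> int \<Rightarrow> real" where
  "add_row x i a = x(i := \<lambda>q. x i q + a * x (i + 1) q)"

text \<open>Linearity in row \<open>i\<close>: the correction is \<open>a\<close> times the
  determinant with row \<open>i + 1\<close> in place of row \<open>i\<close>, which vanishes if row
  \<open>i + 1\<close> is already among the rows. Otherwise the row indices stay strictly
  increasing, so the correction is again a minor of \<open>x\<close>.\<close>

lemma minor_add_row_cases: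
  assumes r: "strict_mono_on {..<k} r"
  obtains "finite_minor (add_row x i a) k r c = finite_minor x k r c"
  | p where "p < k" "r p = i" "Suc p < k \<Longrightarrow> i + 1 < r (Suc p)"
      "finite_minor (add_row x i a) k r c =
        finite_minor x k r c + a * finite_minor x k (r(p := i + 1)) c"
proof (cases "i \<in> r ` {..<k}")
  case False
  then have "finite_minor (add_row x i a) k r c = finite_minor x k r c"
    by (intro finite_minor_cong) (auto simp: add_row_def)
  then show thesis
    by (rule that(1))
next
  case True
  then obtain p where p: "p < k" "r p = i"
    by auto
  let ?M = "\<lambda>p q. x (r p) (c q)"
  have inj: "r q = i \<longleftrightarrow> q = p" if "q < k" for q
    using strict_mono_on_imp_inj_on[OF r] p that by (auto dest: inj_onD)
  have "finite_minor (add_row x i a) k r c =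
      array_det k (?M(p := \<lambda>q. x i (c q) + a * x (i + 1) (c q)))"
    unfolding finite_minor_array using p inj by (intro array_det_cong) (auto simp: add_row_def)
  also have "\<dots> = array_det k (?M(p := \<lambda>q. x i (c q))) + a * array_det k (?M(p := \<lambda>q. x (i + 1) (c q)))"
    using p by (intro array_det_linear)
  also have "array_det k (?M(p := \<lambda>q. x i (c q))) = finite_minor x k r c"
    unfolding finite_minor_array using p by (intro array_det_cong) auto
  finally have eq: "finite_minor (add_row x i a) k r c =
    finite_minor x k r c + a * array_det k (?M(p := \<lambda>q. x (i + 1) (c q)))" .
  show thesis
  proof (cases "Suc p < k \<and> r (Suc p) = i + 1")
    case True
    then have "array_det k (?M(p := \<lambda>q. x (i + 1) (c q))) = 0"
      using p by (intro array_det_identical_rows[of p "Suc p"]) auto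
    then show thesis
      using eq that(1) by simp
  next
    case False
    then have "i + 1 < r (Suc p)" if "Suc p < k"
      using that r p strict_mono_onD[of "{..<k}" r p "Suc p"] by auto
    moreover have "array_det k (?M(p := \<lambda>q. x (i + 1) (c q))) = finite_minor x k (r(p := i + 1)) c"
      unfolding finite_minor_array by (intro array_det_cong) auto
    ultimately show thesis
      using p eq that(2)[of p] by simp
  qed
qed

lemma tnn_add_row:
  assumes "tnn x" "a \<ge> 0"
  shows "tnn (add_row x i a)"
  unfolding tnn_def
proof (intro allI impI)
  fix k and r c :: "nat \<Rightarrow> int"
  assume r: "strict_mono_on {..<k} r" and c: "strict_mono_on {..<k} c"
  show "0 \<le> finite_minor (add_row x i a) k r c"
  proof (cases rule: minor_add_row_cases[OF r, of x i a c])
    case 1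
    then show ?thesis
      using tnnD[OF assms(1) r c] by simp
  next
    case (2 p)
    then have "strict_mono_on {..<k} (r(p := i + 1))"
      using r by (intro strict_mono_on_upd_next)
    then show ?thesis
      using 2 assms tnnD[OF assms(1) _ c] r by simp
  qed
qed

text \<open>The coefficient is the one that makes entry \<open>(i, m)\<close> zero. Multiplied by
  \<open>x (i + 1) m\<close>, a minor that changes becomes the difference of the two sides of
  \<open>minor_ratio_bound\<close>.\<close>

lemma tnn_eliminate:
  assumes "tnn x" "x i m > 0" "x (i + 1) m > 0"
    and "\<And>p q. p \<le> i + 1 \<Longrightarrow> m < q \<Longrightarrow> x p q = 0"
    and "\<And>p. p < i \<Longrightarrow> x p m = 0"
  shows "tnn (add_row x i (- (x i m / x (i + 1) m)))" (is "tnn (add_row x i ?a)")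
  unfolding tnn_def
proof (intro allI impI)
  fix k and r c :: "nat \<Rightarrow> int"
  assume r: "strict_mono_on {..<k} r" and c: "strict_mono_on {..<k} c"
  show "0 \<le> finite_minor (add_row x i ?a) k r c"
  proof (cases rule: minor_add_row_cases[OF r, of x i ?a c])
    case 1
    then show ?thesis
      using tnnD[OF assms(1) r c] by simp
  next
    case (2 p)
    have "x i m * finite_minor x k (r(p := i + 1)) c \<le> x (i + 1) m * finite_minor x k r c"
      using minor_ratio_bound[OF assms r c 2(1-3)] .
    then have "0 \<le> x (i + 1) m * finite_minor (add_row x i ?a) k r c"
      unfolding 2(4) using assms(3) by (simp add: right_diff_distrib)
    then show ?thesis
      using assms(3) by (simp add: zero_le_mult_iff)
  qed
qed

text \<open>The set \<open>S\<close> is arbitrary so that the infinite residue class of a generator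
  can be replaced by finite subsets, which are handled by repeated use of
  \<open>add_row\<close>.\<close>

definition row_add :: "int set \<Rightarrow> real \<Rightarrow> (int \<Rightarrow> int \<Rightarrow> real) \<Rightarrow> int \<Rightarrow> int \<Rightarrow> real" where
  "row_add S a x p q = x p q + (if p \<in> S then a * x (p + 1) q else 0)"

lemma row_add_insert:
  assumes "p \<notin> F" "p + 1 \<notin> F"
  shows "row_add (insert p F) a x = add_row (row_add F a x) p a"
  using assms by (auto simp: row_add_def add_row_def fun_eq_iff)

text \<open>A finite minor only sees finitely many of the rows changed by \<open>row_add\<close>.\<close>

lemma tnn_row_add_finite:
  assumes "\<And>F. finite F \<Longrightarrow> F \<subseteq> S \<Longrightarrow> tnn (row_add F a x)"
  shows "tnn (row_add S a x)"
  unfolding tnn_def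
proof (intro allI impI)
  fix k and r c :: "nat \<Rightarrow> int"
  assume rc: "strict_mono_on {..<k} r" "strict_mono_on {..<k} c"
  have "finite_minor (row_add S a x) k r c = finite_minor (row_add (S \<inter> r ` {..<k}) a x) k r c"
    by (intro finite_minor_cong) (auto simp: row_add_def)
  then show "0 \<le> finite_minor (row_add S a x) k r c"
    using tnnD[OF assms[of "S \<inter> r ` {..<k}"] rc] by simp
qed

lemma tnn_row_add:
  assumes "tnn x" "a \<ge> 0" "\<And>p. p \<in> S \<Longrightarrow> p + 1 \<notin> S"
  shows "tnn (row_add S a x)"
proof (rule tnn_row_add_finite)
  fix F assume "finite F" "F \<subseteq> S"
  then show "tnn (row_add F a x)"
  proof (induction F)
    case empty
    then show ?case
      using assms(1) by (simp add: row_add_def)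
  next
    case (insert p F)
    then have "p + 1 \<notin> F"
      using assms(3) by blast
    then show ?case
      using insert assms(2) by (simp add: row_add_insert tnn_add_row)
  qed
qed

text \<open>The rows of a finite part of \<open>S\<close> are eliminated one at a time. A row
  changed earlier ends at most where its successor ends, and it is never a neighbour of
  \<open>p\<close>. So column \<open>l p\<close> is still zero above row \<open>p\<close>, and the
  rows up to \<open>p + 1\<close> still end by column \<open>l p\<close>, as
  \<open>tnn_eliminate\<close> requires.\<close>

lemma tnn_row_eliminate:
  fixes l :: "int \<Rightarrow> int"
  assumes tnn: "tnn x" and S: "\<And>p. p \<in> S \<Longrightarrow> p + 1 \<notin> S"
    and l_pos: "\<And>p. x p (l p) > 0" and l_zero: "\<And>p q. l p < q \<Longrightarrow> x p q = 0" and l: "mono l"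
    and jump: "\<And>p. p \<in> S \<Longrightarrow> l (p - 1) < l p \<and> l (p + 1) = l p"
    and a: "\<And>p. p \<in> S \<Longrightarrow> a = x p (l p) / x (p + 1) (l p)"
  shows "tnn (row_add S (- a) x)"
proof (rule tnn_row_add_finite)
  fix F assume "finite F" "F \<subseteq> S"
  then show "tnn (row_add F (- a) x)"
  proof (induction F)
    case empty
    then show ?case
      using tnn by (simp add: row_add_def)
  next
    case (insert p F)
    then have p: "p \<in> S" "p \<notin> F" "p + 1 \<notin> F" "p - 1 \<notin> F" and F: "F \<subseteq> S"
      using S[of p] S[of "p - 1"] by auto
    define y where "y = row_add F (- a) x"
    have y: "y p (l p) = x p (l p)" "y (p + 1) (l p) = x (p + 1) (l p)"
      using p by (simp_all add: y_def row_add_def)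
    have mono: "l p' \<le> l p" if "p' \<le> p + 1" for p'
      using monoD[OF l that] jump[OF p(1)] by simp
    have mono': "l p' < l p" if "p' < p" for p'
      using monoD[OF l, of p' "p - 1"] that jump[OF p(1)] by simp
    have "tnn (add_row y p (- (y p (l p) / y (p + 1) (l p))))"
    proof (rule tnn_eliminate)
      show "tnn y"
        using insert by (simp add: y_def)
      show "y p (l p) > 0" "y (p + 1) (l p) > 0"
        using y l_pos[of p] l_pos[of "p + 1"] jump[OF p(1)] by auto
    next
      fix p' q assume *: "p' \<le> p + 1" "l p < q"
      then have "x p' q = 0"
        using mono[of p'] by (intro l_zero) simp
      moreover have "x (p' + 1) q = 0" if "p' \<in> F"
      proof -
        have "p' \<noteq> p + 1" using that p by auto
        then show ?thesis using * mono[of "p' + 1"] by (intro l_zero) simp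
      qed
      ultimately show "y p' q = 0"
        by (simp add: y_def row_add_def)
    next
      fix p' assume *: "p' < p"
      then have "x p' (l p) = 0"
        using mono' by (intro l_zero) simp
      moreover have "x (p' + 1) (l p) = 0" if "p' \<in> F"
      proof -
        have "p' \<noteq> p - 1" using that p by auto
        then show ?thesis using * mono'[of "p' + 1"] by (intro l_zero) simp
      qed
      ultimately show "y p' (l p) = 0"
        by (simp add: y_def row_add_def)
    qed
    then show ?case
      using p y a[OF p(1)] by (simp add: row_add_insert y_def)
  qed
qed

section \<open>Length and reduced words in the affine symmetric group\<close>

lemma periodic_shift:
  fixes f :: "int \<Rightarrow> 'a" and t :: int
  assumes "\<And>k. f (k + m) = f k"
  shows "f (k + t * m) = f k"
proof (induction t rule: int_induct[where k = 0])
  case (step1 t)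
  then show ?case
    using assms[of "k + t * m"] by (simp add: algebra_simps)
next
  case (step2 t)
  then show ?case
    using assms[of "k + (t - 1) * m"] by (simp add: algebra_simps)
qed simp

lemma periodic_cong:
  fixes f :: "int \<Rightarrow> 'a"
  assumes "\<And>k. f (k + m) = f k" "[a = b] (mod m)"
  shows "f a = f b"
proof -
  obtain t where "a = b + t * m"
    using assms(2) by (metis cong_iff_lin cong_sym mult.commute)
  then show ?thesis
    using periodic_shift[of f m b t] assms(1) by simp
qed

lemma quasiperiodic_shift:
  fixes f :: "int \<Rightarrow> int"
  assumes "\<And>k. f (k + m) = f k + m"
  shows "f (k + t * m) = f k + t * m"
  using periodic_shift[of "\<lambda>k. f k - k" m k t] assms by simp

lemma quasiperiodic_descent_cong:
  fixes v :: "int \<Rightarrow> int"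
  assumes v: "\<And>k. v (k + m) = v k + m" and "[a = b] (mod m)"
  shows "v (a + 1) < v a \<longleftrightarrow> v (b + 1) < v b"
proof (rule periodic_cong[where m = m and f = "\<lambda>k. v (k + 1) < v k"])
  show "(v (k + m + 1) < v (k + m)) = (v (k + 1) < v k)" for k
    using v[of "k + 1"] v[of k] by (simp add: ac_simps)
qed fact

text \<open>The function \<open>f k - k\<close> is periodic and weakly increasing, hence
  constant.\<close>

lemma quasiperiodic_increasing:
  fixes f :: "int \<Rightarrow> int"
  assumes "n > 0" "\<And>k. f (k + int n) = f k + int n" "\<And>k. f k < f (k + 1)"
  shows "f k = k + f 0"
proof -
  define g where "g k = f k - k" for k
  have step: "g k \<le> g (k + 1)" for k
    using assms(3)[of k] by (simp add: g_def)
  have up: "g k \<le> g (k + int m)" for k m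
  proof (induction m)
    case (Suc m)
    then show ?case
      using step[of "k + int m"] by (simp add: algebra_simps)
  qed simp
  have "g (k + 1) = g k" for k
  proof (rule antisym[OF _ step])
    show "g (k + 1) \<le> g k"
      \<comment> \<open>The \<open>n - 1\<close> steps from \<open>k + 1\<close> end at
        \<open>k + n\<close>, where \<open>g\<close> has its value at \<open>k\<close>
        again.\<close>
      using up[of "k + 1" "n - 1"] assms(1,2) by (simp add: g_def of_nat_diff)
  qed
  from periodic_shift[of g 1 0 k, OF this] show ?thesis
    by (simp add: g_def)
qed

text \<open>
  The matrix library loads the group inverse of HOL-Algebra, which occupies the notation \<open>inv\<close>.
\<close>

abbreviation perm_inv :: "(int \<Rightarrow> int) \<Rightarrow> int \<Rightarrow> int" where
  "perm_inv w \<equiv> inv_into UNIV w"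

definition descents :: "(int \<Rightarrow> int) \<Rightarrow> int \<Rightarrow> int set" where
  "descents v a = {b. a < b \<and> v b < v a}"

text \<open>Inversions counted modulo the simultaneous shift of both positions by \<open>n\<close>;
  for affine permutations this is the Coxeter length.\<close>

definition inversions :: "nat \<Rightarrow> (int \<Rightarrow> int) \<Rightarrow> nat" where
  "inversions n v = (\<Sum>a = 1..int n. card (descents v a))"

text \<open>Words grow on the left, and left multiplication of \<open>w\<close> by a simple
  reflection exchanges adjacent positions of the inverse of \<open>w\<close>, where inversions are
  easy to follow.\<close>

definition affine_len :: "nat \<Rightarrow> (int \<Rightarrow> int) \<Rightarrow> nat" where
  "affine_len n w = inversions n (perm_inv w)"

lemma word_perm_simps [simp]:
  "word_perm n [] = id" "word_perm n (i # ws) = affine_s n i \<circ> word_perm n ws"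
  by (simp_all add: word_perm_def)

context
  fixes n :: nat
  assumes n: "n \<ge> 2"
begin

section \<open>Simple reflections and the sum condition\<close>

lemma not_cong_Suc: "[k = i] (mod int n) \<Longrightarrow> \<not> [k + 1 = i] (mod int n)"
proof
  assume "[k = i] (mod int n)" "[k + 1 = i] (mod int n)"
  then have "[k + 1 = k] (mod int n)"
    by (blast intro: cong_trans cong_sym)
  then have "int n dvd 1"
    by (simp add: cong_iff_dvd_diff)
  then show False
    using n by simp
qed

lemma cong_add_1: "[k + 1 = i + 1] (mod int n) \<longleftrightarrow> [k = i] (mod int n)"
  by (rule cong_add_rcancel)

lemma affine_s_cases:
  obtains "[k = i] (mod int n)" "\<not> [k + 1 = i] (mod int n)" "\<not> [k - 1 = i] (mod int n)"
      "affine_s n i k = k + 1"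
  | "[k - 1 = i] (mod int n)" "\<not> [k = i] (mod int n)" "affine_s n i k = k - 1"
  | "\<not> [k = i] (mod int n)" "\<not> [k - 1 = i] (mod int n)" "affine_s n i k = k"
  using not_cong_Suc[of k i] not_cong_Suc[of "k - 1" i] cong_add_1[of "k - 1" i]
  by (auto simp: affine_s_def)

lemma affine_s_invol [simp]: "affine_s n i (affine_s n i k) = k"
  by (cases rule: affine_s_cases[of k i]) (simp_all add: affine_s_def cong_add_1)

lemma affine_s_comp [simp]: "affine_s n i \<circ> affine_s n i = id"
  by (simp add: fun_eq_iff)

lemma affine_s_comp_comp [simp]: "affine_s n i \<circ> (affine_s n i \<circ> w) = w"
  by (simp add: fun_eq_iff)

lemma affine_s_image_iff: "b \<in> affine_s n i ` X \<longleftrightarrow> affine_s n i b \<in> X"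
  by (auto intro: rev_image_eqI)

lemma bij_affine_s: "bij (affine_s n i)"
  by (rule o_bij[where g = "affine_s n i"]) simp_all

lemma inv_affine_s: "perm_inv (affine_s n i) = affine_s n i"
  by (rule inv_unique_comp) simp_all

lemma affine_s_periodic: "affine_s n i (k + int n) = affine_s n i k + int n"
  by (simp add: affine_s_def cong_def)

text \<open>The map \<open>\<sigma>\<close> permutes the residue classes modulo \<open>n\<close>;
  the auxiliary \<open>h\<close> is this permutation on the representatives from 1 to
  \<open>n\<close>.\<close>

lemma sum_periodic_perm:
  fixes f :: "int \<Rightarrow> 'a :: comm_monoid_add"
  assumes f: "\<And>k. f (k + int n) = f k"
    and \<sigma>: "inj \<sigma>" "\<And>k. \<sigma> (k + int n) = \<sigma> k + int n"
  shows "(\<Sum>k = 1..int n. f (\<sigma> k)) = (\<Sum>k = 1..int n. f k)"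
proof -
  define h where "h k = (\<sigma> k - 1) mod int n + 1" for k
  have cong_h: "[h k = \<sigma> k] (mod int n)" for k
    by (metis cong_add_rcancel cong_mod_left cong_refl diff_add_cancel h_def)
  have "inj_on h {1..int n}"
  proof (rule inj_onI)
    fix k l assume kl: "k \<in> {1..int n}" "l \<in> {1..int n}" "h k = h l"
    then have "[\<sigma> k = \<sigma> l] (mod int n)"
      using cong_h by (metis cong_sym cong_trans)
    then obtain t where "\<sigma> k = \<sigma> l + t * int n"
      by (metis cong_iff_lin cong_sym mult.commute)
    then have "\<sigma> k = \<sigma> (l + t * int n)"
      using quasiperiodic_shift[of \<sigma> "int n" l t] \<sigma>(2) by simp
    then have "k = l + t * int n"
      using \<sigma>(1) by (auto dest: injD)
    then have "[k - 1 = l - 1] (mod int n)"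
      by (simp add: cong_iff_dvd_diff)
    then show "k = l"
      using kl by (simp add: cong_def)
  qed
  moreover have "h ` {1..int n} \<subseteq> {1..int n}"
    using n pos_mod_bound[of "int n"] by (auto simp: h_def add1_zle_eq)
  ultimately have bij: "bij_betw h {1..int n} {1..int n}"
    by (simp add: bij_betw_def endo_inj_surj)
  have "(\<Sum>k = 1..int n. f (\<sigma> k)) = (\<Sum>k = 1..int n. f (h k))"
    using periodic_cong[of f "int n", OF f cong_h] by simp
  also have "\<dots> = (\<Sum>k = 1..int n. f k)"
    by (rule sum.reindex_bij_betw[OF bij])
  finally show ?thesis .
qed

lemma sum_indicator_cong: "(\<Sum>a = 1..int n. of_bool ([a = i] (mod int n))) = (1 :: nat)"
proof -
  have "{a. 1 \<le> a \<and> a \<le> int n \<and> [a = i] (mod int n)} = {(i - 1) mod int n + 1}"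
  proof (intro equalityI subsetI)
    fix a assume "a \<in> {a. 1 \<le> a \<and> a \<le> int n \<and> [a = i] (mod int n)}"
    then have "0 \<le> a - 1" "a - 1 < int n" "[a - 1 = i - 1] (mod int n)"
      by (auto simp: cong_diff)
    then have "a - 1 = (i - 1) mod int n"
      by (simp add: cong_def)
    then show "a \<in> {(i - 1) mod int n + 1}"
      by simp
  next
    have "[(i - 1) mod int n + 1 = (i - 1) + 1] (mod int n)"
      by (intro cong_add) auto
    moreover have "(i - 1) mod int n < int n" "0 \<le> (i - 1) mod int n"
      using n by simp_all
    moreover fix a assume "a \<in> {(i - 1) mod int n + 1}"
    ultimately show "a \<in> {a. 1 \<le> a \<and> a \<le> int n \<and> [a = i] (mod int n)}"
      by auto
  qed
  then show ?thesis
    by (simp add: of_bool_def sum.If_cases Int_def)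
qed

lemma sum_affine_s_diff: "(\<Sum>k = 1..int n. affine_s n i k - k) = 0"
proof -
  let ?f = "\<lambda>k. of_bool ([k = i] (mod int n)) :: int"
  have "affine_s n i k - k = ?f k - ?f (k - 1)" for k
    by (cases rule: affine_s_cases[of k i]) auto
  then have "(\<Sum>k = 1..int n. affine_s n i k - k) =
      (\<Sum>k = 1..int n. ?f k) - (\<Sum>k = 1..int n. ?f (k - 1))"
    by (simp add: sum_subtractf)
  also have "(\<Sum>k = 1..int n. ?f (k - 1)) = (\<Sum>k = 1..int n. ?f k)"
    by (rule sum_periodic_perm) (auto simp: cong_def inj_def)
  finally show ?thesis
    by simp
qed

text \<open>For the sum condition, the displacement caused by the reflection is summed over the
  values of \<open>w\<close> on one period. These run through all residue classes, so the total is
  the same as for the identity, namely zero.\<close>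

lemma affine_s_mem:
  assumes "w \<in> affine_sym n"
  shows "affine_s n i \<circ> w \<in> affine_sym n"
proof -
  have w: "bij w" "\<And>k. w (k + int n) = w k + int n" "(\<Sum>k = 1..int n. w k) = (\<Sum>k = 1..int n. k)"
    using assms by (auto simp: affine_sym_def)
  have "(\<Sum>k = 1..int n. affine_s n i (w k)) = (\<Sum>k = 1..int n. affine_s n i (w k) - w k) +
      (\<Sum>k = 1..int n. w k)"
    by (simp add: sum.distrib[symmetric])
  also have "(\<Sum>k = 1..int n. affine_s n i (w k) - w k) = (\<Sum>k = 1..int n. affine_s n i k - k)"
    using w by (intro sum_periodic_perm[where f = "\<lambda>k. affine_s n i k - k"])
      (auto simp: affine_s_periodic bij_def)
  finally show ?thesis
    using w by (auto
        simp: affine_sym_def sum_affine_s_diff affine_s_periodic intro: bij_comp bij_affine_s)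
qed

lemma word_perm_mem: "word_perm n ws \<in> affine_sym n"
proof (induction ws)
  case Nil
  show ?case
    by (simp add: affine_sym_def bij_def)
next
  case (Cons i ws)
  then show ?case
    unfolding word_perm_simps by (rule affine_s_mem)
qed

lemma inv_affine_sym:
  assumes "w \<in> affine_sym n"
  shows "inj (perm_inv w)" "perm_inv w (k + int n) = perm_inv w k + int n"
proof -
  have w: "bij w" "\<And>k. w (k + int n) = w k + int n"
    using assms by (auto simp: affine_sym_def)
  then show "inj (perm_inv w)"
    by (simp add: bij_imp_bij_inv bij_is_inj)
  show "perm_inv w (k + int n) = perm_inv w k + int n"
    using w by (metis bij_inv_eq_iff)
qed

lemma inv_affine_s_comp:
  assumes "w \<in> affine_sym n"
  shows "perm_inv (affine_s n i \<circ> w) = perm_inv w \<circ> affine_s n i"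
  using assms by (simp add: affine_sym_def o_inv_distrib bij_affine_s inv_affine_s)

text \<open>Without descents the inverse is a shift, and the sum condition in
  \<open>affine_sym\<close> leaves only the trivial shift.\<close>

lemma affine_sym_eq_id:
  assumes "w \<in> affine_sym n" "\<And>i. i \<in> {0..<int n} \<Longrightarrow> perm_inv w i < perm_inv w (i + 1)"
  shows "w = id"
proof -
  have w: "bij w" "(\<Sum>k = 1..int n. w k) = (\<Sum>k = 1..int n. k)"
    using assms(1) by (auto simp: affine_sym_def)
  have "perm_inv w k < perm_inv w (k + 1)" for k
  proof -
    have "\<not> perm_inv w (k mod int n + 1) < perm_inv w (k mod int n)"
      using assms(2)[of "k mod int n"] n by simp
    moreover have "[k = k mod int n] (mod int n)"
      by (simp add: cong_def)
    ultimately have "\<not> perm_inv w (k + 1) < perm_inv w k"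
      using quasiperiodic_descent_cong[of "perm_inv w", OF inv_affine_sym(2)[OF assms(1)]] by blast
    moreover have "perm_inv w k \<noteq> perm_inv w (k + 1)"
      by (simp add: inj_eq[OF inv_affine_sym(1)[OF assms(1)]])
    ultimately show ?thesis
      by simp
  qed
  then have shift: "perm_inv w k = k + perm_inv w 0" for k
    using inv_affine_sym(2)[OF assms(1)] n by (intro quasiperiodic_increasing[where n = n]) auto
  have wk: "w k = k - perm_inv w 0" for k
    using shift[of "w k"] inv_f_f[OF bij_is_inj[OF w(1)], of k] by simp
  then have "(\<Sum>k = 1..int n. k) - int n * perm_inv w 0 = (\<Sum>k = 1..int n. k)"
    using w(2) by (simp add: sum_subtractf)
  then have "perm_inv w 0 = 0"
    using n by simp
  then show ?thesis
    using wk by (simp add: fun_eq_iff)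
qed

section \<open>Inversions under a simple reflection\<close>

lemma finite_descents:
  assumes "\<And>k. v (k + int n) = v k + int n"
  shows "finite (descents v a)"
proof -
  \<comment> \<open>\<open>v b - b\<close> is periodic, so its minimum over one period bounds it
    from below everywhere; a position \<open>b\<close> with \<open>v b < v a\<close> then cannot
    exceed \<open>v a - m\<close>.\<close>
  define m where "m = Min ((\<lambda>k. v k - k) ` {0..<int n})"
  have "v b - b \<ge> m" for b
  proof -
    have "v b - b = v (b mod int n) - b mod int n"
      using assms by - (rule periodic_cong[where m = "int n" and f = "\<lambda>k. v k - k"]; simp add: cong_def)
    also have "\<dots> \<ge> m"
      unfolding m_def using n by (intro Min_le) auto
    finally show ?thesis .
  qed
  then have "b \<in> {a..v a - m}" if "b \<in> descents v a" for b
    using that by (smt (verit) atLeastAtMost_iff descents_def mem_Collect_eq)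
  then have "descents v a \<subseteq> {a..v a - m}"
    by blast
  then show ?thesis
    by (rule finite_subset) simp
qed

lemma card_descents_periodic:
  assumes "\<And>k. v (k + int n) = v k + int n"
  shows "card (descents v (a + int n)) = card (descents v a)"
proof -
  have "descents v (a + int n) = (\<lambda>b. b + int n) ` descents v a"
  proof (intro equalityI subsetI)
    fix b assume "b \<in> descents v (a + int n)"
    then have "b - int n \<in> descents v a"
      using assms[of "b - int n"] assms[of a] by (simp add: descents_def)
    then show "b \<in> (\<lambda>b. b + int n) ` descents v a"
      by (rule rev_image_eqI) simp
  qed (auto simp: descents_def assms)
  then show ?thesis
    by (simp add: card_image)
qed

lemma affine_s_less:
  assumes "a < b"
  shows "affine_s n i a < affine_s n i b \<or> [a = i] (mod int n) \<and> b = a + 1"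
proof -
  consider "b = a + 1" | "b = a + 2" | "a + 2 < b"
    using assms by linarith
  then show ?thesis
  proof cases
    case 1
    then show ?thesis
      by (cases rule: affine_s_cases[of a i]; cases rule: affine_s_cases[of b i]) auto
  next
    case 2
    have "\<not> [1 + a = i] (mod int n)" if "[a = i] (mod int n)"
      using not_cong_Suc[OF that] by (simp add: add.commute)
    then show ?thesis
      using 2 by (cases rule: affine_s_cases[of a i]; cases rule: affine_s_cases[of b i]) auto
  next
    case 3
    have "affine_s n i a \<le> a + 1"
      by (cases rule: affine_s_cases[of a i]) auto
    moreover have "affine_s n i b \<ge> b - 1"
      by (cases rule: affine_s_cases[of b i]) auto
    ultimately show ?thesis
      using 3 by linarith
  qed
qed

text \<open>The reflection carries inversions to inversions, except that the pairs
  \<open>(a, a + 1)\<close> with \<open>a\<close> congruent to \<open>i\<close>, all of them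
  inversions of \<open>v\<close>, disappear. Each period contains exactly one such \<open>a\<close>.
  The reflection also moves the summation window, which \<open>sum_periodic_perm\<close>
  corrects.\<close>

lemma inversions_affine_s:
  assumes v: "inj v" "\<And>k. v (k + int n) = v k + int n" and "v (i + 1) < v i"
  shows "inversions n v = Suc (inversions n (v \<circ> affine_s n i))"
proof -
  let ?s = "affine_s n i"
  have desc: "v (a + 1) < v a" if "[a = i] (mod int n)" for a
    using quasiperiodic_descent_cong[of v, OF v(2) that] assms(3) by simp
  have eq: "descents (v \<circ> ?s) (?s a) =
      ?s ` (descents v a - (if [a = i] (mod int n) then {a + 1} else {}))" for a
  proof -
    have "b \<in> descents (v \<circ> ?s) (?s a) \<longleftrightarrow>
        ?s b \<in> descents v a - (if [a = i] (mod int n) then {a + 1} else {})" for b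
    proof -
      consider "a < ?s b" | "?s b < a" | "a = ?s b"
        by linarith
      then show ?thesis
      proof cases
        case 1
        then have "?s a < b \<or> [a = i] (mod int n) \<and> ?s b = a + 1"
          using affine_s_less[of a "?s b" i] by simp
        moreover have "\<not> ?s a < b" if "[a = i] (mod int n)" "?s b = a + 1"
        proof -
          have "?s a = a + 1" using that by (simp add: affine_s_def)
          then have "b = a" using that affine_s_invol[of i a] affine_s_invol[of i b] by simp
          then show ?thesis using \<open>?s a = a + 1\<close> by simp
        qed
        ultimately show ?thesis
          using 1 by (auto simp: descents_def)
      next
        case 2
        then have "b < ?s a \<or> [?s b = i] (mod int n) \<and> a = ?s b + 1"
          using affine_s_less[of "?s b" a i] by simp
        then show ?thesis
          using 2 desc[of "?s b"] by (auto simp: descents_def)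
      qed (auto simp: descents_def)
    qed
    then show ?thesis
      unfolding set_eq_iff affine_s_image_iff by blast
  qed
  have card: "card (descents v a) = card (descents (v \<circ> ?s) (?s a)) +
      of_bool ([a = i] (mod int n))" for a
  proof -
    have "inj ?s"
      using bij_affine_s by (rule bij_is_inj)
    then have "card (descents (v \<circ> ?s) (?s a)) =
        card (descents v a - (if [a = i] (mod int n) then {a + 1} else {}))"
      unfolding eq by (intro card_image) (auto intro: inj_on_subset)
    moreover have "a + 1 \<in> descents v a" if "[a = i] (mod int n)"
      using desc[OF that] by (simp add: descents_def)
    ultimately show ?thesis
      using finite_descents[of v a, OF v(2)] card_gt_0_iff[of "descents v a"] by auto
  qed
  have "inversions n v = (\<Sum>a = 1..int n. card (descents (v \<circ> ?s) (?s a))) + 1"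
    by (simp add: inversions_def card sum.distrib sum_indicator_cong)
  also have "(\<Sum>a = 1..int n. card (descents (v \<circ> ?s) (?s a))) = inversions n (v \<circ> ?s)"
    unfolding inversions_def
    by (rule sum_periodic_perm[where f = "\<lambda>a. card (descents (v \<circ> ?s) a)"])
      (auto simp: bij_is_inj[OF bij_affine_s] affine_s_periodic v(2) intro!: card_descents_periodic)
  finally show ?thesis
    by simp
qed

section \<open>Length, words and the exchange property\<close>

lemma affine_len_desc:
  assumes "w \<in> affine_sym n" "perm_inv w (i + 1) < perm_inv w i"
  shows "affine_len n w = Suc (affine_len n (affine_s n i \<circ> w))"
  unfolding affine_len_def inv_affine_s_comp[OF assms(1)]
  using assms by (intro inversions_affine_s) (auto simp: inv_affine_sym)

lemma affine_s_at: "affine_s n i i = i + 1" "affine_s n i (i + 1) = i"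
  using not_cong_Suc[of i i] by (simp_all add: affine_s_def)

lemma affine_len_asc:
  assumes "w \<in> affine_sym n" "perm_inv w i < perm_inv w (i + 1)"
  shows "affine_len n (affine_s n i \<circ> w) = Suc (affine_len n w)"
  using affine_len_desc[OF affine_s_mem[OF assms(1)], of i i] assms
  by (simp add: inv_affine_s_comp affine_s_at)

lemma inv_neq: "w \<in> affine_sym n \<Longrightarrow> perm_inv w i \<noteq> perm_inv w (i + 1)"
  by (simp add: inj_eq[OF inv_affine_sym(1)])

lemma affine_len_le_length: "affine_len n (word_perm n ws) \<le> length ws"
proof (induction ws)
  case Nil
  then show ?case
    by (simp add: affine_len_def inversions_def descents_def)
next
  case (Cons i ws)
  let ?w = "word_perm n ws"
  have "affine_len n (affine_s n i \<circ> ?w) \<le> Suc (affine_len n ?w)"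
    using affine_len_asc[of ?w i, OF word_perm_mem] affine_len_desc[of ?w i, OF word_perm_mem]
      inv_neq[of ?w i, OF word_perm_mem] by linarith
  also have "\<dots> \<le> Suc (length ws)"
    using Cons.IH by simp
  finally show ?case
    unfolding word_perm_simps(2) list.size(4) by linarith
qed

lemma ex_word_affine_len:
  assumes "w \<in> affine_sym n"
  shows "\<exists>ws \<in> words n. word_perm n ws = w \<and> length ws = affine_len n w"
  using assms
proof (induction "affine_len n w" arbitrary: w rule: less_induct)
  case less
  show ?case
  proof (cases "w = id")
    case True
    then show ?thesis
      using affine_len_le_length[of "[]"] by (intro bexI[of _ "[]"]) (auto simp: words_def)
  next
    case False
    then obtain i where i: "i \<in> {0..<int n}" "\<not> perm_inv w i < perm_inv w (i + 1)"
      using affine_sym_eq_id[OF less.prems] by blast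
    then have len: "affine_len n w = Suc (affine_len n (affine_s n i \<circ> w))"
      using affine_len_desc[OF less.prems] inv_neq[OF less.prems] by (meson linorder_less_linear)
    then obtain ws where "ws \<in> words n" "word_perm n ws = affine_s n i \<circ> w"
        "length ws = affine_len n (affine_s n i \<circ> w)"
      using less.hyps[of "affine_s n i \<circ> w", OF _ affine_s_mem[OF less.prems]] by auto
    then show ?thesis
      using i len by (intro bexI[of _ "i # ws"]) (auto simp: words_def)
  qed
qed

text \<open>Each letter changes the number of inversions by one, so no word is shorter than that
  number; peeling off descents until none is left gives a word that attains it.\<close>

lemma reduced_word_iff:
  "reduced_word n w ws \<longleftrightarrow> ws \<in> words n \<and> word_perm n ws = w \<and> length ws = affine_len n w"
proof
  assume red: "reduced_word n w ws"
  then have "w \<in> affine_sym n"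
    using word_perm_mem by (auto simp: reduced_word_def)
  then obtain js where "js \<in> words n" "word_perm n js = w" "length js = affine_len n w"
    using ex_word_affine_len by blast
  then show "ws \<in> words n \<and> word_perm n ws = w \<and> length ws = affine_len n w"
    using red affine_len_le_length[of ws] by (force simp: reduced_word_def)
next
  assume "ws \<in> words n \<and> word_perm n ws = w \<and> length ws = affine_len n w"
  then show "reduced_word n w ws"
    unfolding reduced_word_def using affine_len_le_length by metis
qed

lemma reduced_word_mem: "reduced_word n w ws \<Longrightarrow> w \<in> affine_sym n"
  using word_perm_mem by (auto simp: reduced_word_def)

lemma ex_reduced_word: "w \<in> affine_sym n \<Longrightarrow> \<exists>ws. reduced_word n w ws"
  using ex_word_affine_len by (auto simp: reduced_word_iff)

text \<open>Together with \<open>ex_reduced_word\<close>, this lets a reduced word of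
  \<open>w\<close> start with any prescribed descent of the inverse, which is how the exchange
  property is used later.\<close>

lemma reduced_word_Cons:
  assumes "reduced_word n (affine_s n i \<circ> w) us" "perm_inv w (i + 1) < perm_inv w i"
      "i \<in> {0..<int n}"
    "w \<in> affine_sym n"
  shows "reduced_word n w (i # us)"
  using assms affine_len_desc[of w i] by (auto simp: reduced_word_iff words_def)

lemma reduced_word_ConsD:
  assumes "reduced_word n w (i # us)"
  shows "perm_inv w (i + 1) < perm_inv w i" "reduced_word n (affine_s n i \<circ> w) us" "i \<in> {0..<int n}"
proof -
  have w: "w \<in> affine_sym n"
    using assms by (rule reduced_word_mem)
  have us: "word_perm n us = affine_s n i \<circ> w" "us \<in> words n" "affine_len n w = Suc (length us)"
    using assms by (auto simp: reduced_word_iff words_def)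
  then have "affine_len n (affine_s n i \<circ> w) \<le> length us"
    using affine_len_le_length[of us] by simp
  then show "perm_inv w (i + 1) < perm_inv w i"
    using us(3) affine_len_asc[OF w, of i] inv_neq[OF w, of i] by linarith
  then show "reduced_word n (affine_s n i \<circ> w) us"
    using us affine_len_desc[OF w] by (simp add: reduced_word_iff)
  show "i \<in> {0..<int n}"
    using assms by (auto simp: reduced_word_iff words_def)
qed

end

section \<open>Cells of unfolded matrices\<close>

abbreviation chev :: "nat \<Rightarrow> int \<Rightarrow> real \<Rightarrow> (int \<Rightarrow> int \<Rightarrow> real) \<Rightarrow> int \<Rightarrow> int \<Rightarrow> real" where
  "chev n i \<equiv> row_add {p. [p = i] (mod int n)}"

definition id_unfolded :: "int \<Rightarrow> int \<Rightarrow> real" where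
  "id_unfolded p q = of_bool (p = q)"

text \<open>The unfolded form of \<open>E_word\<close>, built by left multiplications so that
  inductions peel off the first letter.\<close>

fun cell :: "nat \<Rightarrow> int list \<Rightarrow> (int \<Rightarrow> int \<Rightarrow> real) set" where
  "cell n [] = {id_unfolded}"
| "cell n (i # ws) = {chev n i a x | a x. 0 < a \<and> x \<in> cell n ws}"

lemma cong_common: "[p = a] (mod m) \<Longrightarrow> [p = b] (mod m) \<Longrightarrow> [a = b] (mod m)"
  by (rule cong_trans[OF cong_sym])

lemma int_near:
  "p + 1 + 1 = p + 2" "p + 1 - 1 = p" "p + 2 - 1 = p + 1" "p - 1 + 1 = p" "p - 1 - 1 = p - 2"
  "p - 1 + 2 = p + 1" "p - 2 + 1 = p - 1" for p :: int
  by simp_all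

lemma cong_class_eq: "[i = j] (mod m) \<Longrightarrow> {p. [p = i] (mod m)} = {p. [p = j] (mod m)}"
  by (auto intro: cong_trans cong_sym)

lemma affine_s_cong: "[i = j] (mod int n) \<Longrightarrow> affine_s n i = affine_s n j"
proof -
  assume ij: "[i = j] (mod int n)"
  then have "[i + 1 = j + 1] (mod int n)"
    by (intro cong_add) auto
  with ij have "[k = i] (mod int n) \<longleftrightarrow> [k = j] (mod int n)"
    "[k = i + 1] (mod int n) \<longleftrightarrow> [k = j + 1] (mod int n)" for k
    by (blast intro: cong_trans cong_sym)+
  then show ?thesis
    by (simp add: affine_s_def fun_eq_iff)
qed

context
  fixes n :: nat
  assumes n: "n \<ge> 2"
begin

section \<open>Relations between the generators\<close>

lemma chev_add: "chev n i a (chev n i b x) = chev n i (a + b) x"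
  using not_cong_Suc[OF n] by (auto simp: row_add_def fun_eq_iff algebra_simps)

lemma chev_commute:
  assumes "\<not> [j = i + 1] (mod int n)" "\<not> [i = j + 1] (mod int n)"
  shows "chev n i a (chev n j b x) = chev n j b (chev n i a x)"
proof -
  have "\<not> ([p = i] (mod int n) \<and> [p + 1 = j] (mod int n))"
       "\<not> ([p = j] (mod int n) \<and> [p + 1 = i] (mod int n))" for p
    using assms cong_add_1[OF n, of p i] cong_add_1[OF n, of p j]
      cong_common[of "p + 1" j "int n" "i + 1"] cong_common[of "p + 1" i "int n" "j + 1"]
    by auto
  then show ?thesis
    by (auto simp: row_add_def fun_eq_iff algebra_simps)
qed

lemma cong_near:
  assumes "n \<ge> 3" "[p = i] (mod int n)"
  shows "\<not> [p + 1 = i] (mod int n)" "\<not> [p + 2 = i] (mod int n)"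
    "\<not> [p - 1 = i] (mod int n)" "\<not> [p - 2 = i] (mod int n)"
proof -
  have *: "\<not> [p + d = i] (mod int n)" if "d \<noteq> 0" "\<bar>d\<bar> < 3" for d
  proof
    assume "[p + d = i] (mod int n)"
    then have "[p + d = p] (mod int n)"
      using assms(2) by (blast intro: cong_trans cong_sym)
    then have "int n dvd d"
      by (simp add: cong_iff_dvd_diff)
    then show False
      using assms(1) that zdvd_imp_le[of "int n" "\<bar>d\<bar>"] by simp
  qed
  show "\<not> [p + 1 = i] (mod int n)" "\<not> [p + 2 = i] (mod int n)"
    "\<not> [p - 1 = i] (mod int n)" "\<not> [p - 2 = i] (mod int n)"
    using *[of 1] *[of 2] *[of "-1"] *[of "-2"] by simp_all
qed

lemma cong_Suc_iff: "[p = i + 1] (mod int n) \<longleftrightarrow> [p - 1 = i] (mod int n)"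
  using cong_add_1[OF n, of "p - 1" i] by simp

text \<open>On consecutive rows of classes \<open>i\<close>, \<open>i + 1\<close>,
  \<open>i + 2\<close> both sides are products of unipotent 3 by 3 matrices. Comparing their entries
  gives the parameters: the middle one is \<open>a + c\<close>, the outer ones add up to
  \<open>b\<close>, and the corner entry fixes their ratio. The condition \<open>n \<ge> 3\<close>
  ensures that rows of class \<open>i + 2\<close> stay unchanged.\<close>

lemma chev_braid:
  fixes x :: "int \<Rightarrow> int \<Rightarrow> real"
  assumes "n \<ge> 3" "a > 0" "c > 0"
  shows "chev n i a (chev n (i + 1) b (chev n i c x)) =
      chev n (i + 1) (b * c / (a + c)) (chev n i (a + c) (chev n (i + 1) (a * b / (a + c)) x))"
      (is "?l1 = ?r1")
    and "chev n (i + 1) a (chev n i b (chev n (i + 1) c x)) =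
      chev n i (b * c / (a + c)) (chev n (i + 1) (a + c) (chev n i (a * b / (a + c)) x))"
      (is "?l2 = ?r2")
proof -
  define d where "d = a * b / (a + c)"
  define e where "e = b * c / (a + c)"
  have ac: "a + c \<noteq> 0"
    using assms by simp
  then have "(a + c) * (d + e) = (a + c) * b"
    by (simp add: d_def e_def distrib_left mult.commute)
  with ac have b: "b = d + e"
    by simp
  have "(a + c) * d = a * b"
    using ac by (simp add: d_def)
  \<comment> \<open>Given \<open>b = d + e\<close>, this is the equality of the corner entries, for
    both relations.\<close>
  then have ae: "a * e = c * d"
    by (simp add: b algebra_simps)
  define j where "j = i + 1"
  have J: "[p = j] (mod int n) \<longleftrightarrow> [p - 1 = i] (mod int n)" for p
    by (simp only: j_def cong_Suc_iff)
  note eval = row_add_def mem_Collect_eq J int_near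
  let ?L1 = "chev n i a (chev n j b (chev n i c x))"
  let ?R1 = "chev n j e (chev n i (a + c) (chev n j d x))"
  let ?L2 = "chev n j a (chev n i b (chev n j c x))"
  let ?R2 = "chev n i e (chev n j (a + c) (chev n i d x))"
  have "?L1 p q = ?R1 p q \<and> ?L2 p q = ?R2 p q" for p q
  proof -
    consider "[p = i] (mod int n)" | "[p - 1 = i] (mod int n)"
      | "\<not> [p = i] (mod int n)" "\<not> [p - 1 = i] (mod int n)"
      by blast
    then show ?thesis
    proof cases
      case 1
      show ?thesis
        using 1 ae cong_near[OF assms(1) 1] by (simp add: eval) (simp add: b algebra_simps)
    next
      case 2
      show ?thesis
        using 2 cong_near[OF assms(1) 2] by (simp add: eval) (simp add: b algebra_simps)
    next
      case 3
      then show ?thesis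
        by (simp add: eval)
    qed
  qed
  then show "?l1 = ?r1" "?l2 = ?r2"
    unfolding j_def d_def e_def by blast+
qed

lemma cell_commute:
  assumes "\<not> [j = i + 1] (mod int n)" "\<not> [i = j + 1] (mod int n)"
  shows "cell n (i # j # us) = cell n (j # i # us)"
proof -
  have "cell n (i # j # us) \<subseteq> cell n (j # i # us)"
    if "\<not> [j = i + 1] (mod int n)" "\<not> [i = j + 1] (mod int n)" for i j
  proof
    fix y assume "y \<in> cell n (i # j # us)"
    then obtain a b x where "y = chev n i a (chev n j b x)" "a > 0" "b > 0" "x \<in> cell n us"
      by auto
    then have "y = chev n j b (chev n i a x)" "a > 0" "b > 0" "x \<in> cell n us"
      using chev_commute[OF that] by auto
    then show "y \<in> cell n (j # i # us)"
      by auto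
  qed
  then show ?thesis
    using assms by blast
qed

text \<open>The new parameters are given by formulas without subtraction, so they are positive
  again; the two relations of \<open>chev_braid\<close> provide the two inclusions.\<close>

lemma cell_braid:
  assumes "n \<ge> 3" "[j = i + 1] (mod int n)"
  shows "cell n (i # j # i # us) = cell n (j # i # j # us)"
proof -
  have ch: "chev n j = chev n (i + 1)"
    using cong_class_eq[OF assms(2)] by simp
  show ?thesis
  proof (intro equalityI subsetI)
    fix y assume "y \<in> cell n (i # j # i # us)"
    then obtain a b c x where y: "y = chev n i a (chev n (i + 1) b (chev n i c x))"
        "a > 0" "b > 0" "c > 0" "x \<in> cell n us"
      by (auto simp: ch)
    then have "b * c / (a + c) > 0" "a + c > 0" "a * b / (a + c) > 0"
      by (auto intro!: divide_pos_pos)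
    then show "y \<in> cell n (j # i # j # us)"
      unfolding y(1) chev_braid(1)[OF assms(1) y(2,4)] cell.simps ch using y(5) by blast
  next
    fix y assume "y \<in> cell n (j # i # j # us)"
    then obtain a b c x where y: "y = chev n (i + 1) a (chev n i b (chev n (i + 1) c x))"
        "a > 0" "b > 0" "c > 0" "x \<in> cell n us"
      by (auto simp: ch)
    then have "b * c / (a + c) > 0" "a + c > 0" "a * b / (a + c) > 0"
      by (auto intro!: divide_pos_pos)
    then show "y \<in> cell n (i # j # i # us)"
      unfolding y(1) chev_braid(2)[OF assms(1) y(2,4)] cell.simps ch using y(5) by blast
  qed
qed

section \<open>The same relations between simple reflections\<close>

lemma affine_s_eq:
  "affine_s n i k = (if [k = i] (mod int n) then k + 1
      else if [k - 1 = i] (mod int n) then k - 1 else k)"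
  by (simp add: affine_s_def cong_Suc_iff)

lemma affine_s_commute:
  assumes "\<not> [j = i + 1] (mod int n)" "\<not> [i = j + 1] (mod int n)" "\<not> [i = j] (mod int n)"
  shows "affine_s n i \<circ> affine_s n j = affine_s n j \<circ> affine_s n i"
proof
  fix k
  have excl: "\<not> [t = j] (mod int n)" "\<not> [t + 1 = j] (mod int n)" "\<not> [t - 1 = j] (mod int n)"
      "\<not> [t + 1 = i] (mod int n)"
    if "[t = i] (mod int n)" "\<not> [j = i + 1] (mod int n)" "\<not> [i = j + 1] (mod int n)"
      "\<not> [i = j] (mod int n)" for i j t
  proof -
    have t: "[t + 1 = i + 1] (mod int n)"
      using that(1) by (simp only: cong_add_1[OF n])
    show "\<not> [t = j] (mod int n)" "\<not> [t + 1 = j] (mod int n)"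
      using that t cong_common[of t i "int n" j] cong_common[of "t + 1" j "int n" "i + 1"] by auto
    show "\<not> [t - 1 = j] (mod int n)"
      using that cong_common[of t i "int n" "j + 1"] by (auto simp: cong_Suc_iff)
    show "\<not> [t + 1 = i] (mod int n)"
      using that(1) by (rule not_cong_Suc[OF n])
  qed
  note ij = excl[OF _ assms]
  have ji: "\<not> [t = i] (mod int n)" "\<not> [t + 1 = i] (mod int n)" "\<not> [t - 1 = i] (mod int n)"
      "\<not> [t + 1 = j] (mod int n)" if "[t = j] (mod int n)" for t
    using excl[OF that assms(2,1)] assms(3) cong_sym by blast+
  consider "[k = i] (mod int n)" | "[k - 1 = i] (mod int n)"
    | "[k = j] (mod int n)" | "[k - 1 = j] (mod int n)"
    | "\<not> [k = i] (mod int n)" "\<not> [k - 1 = i] (mod int n)"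
      "\<not> [k = j] (mod int n)" "\<not> [k - 1 = j] (mod int n)"
    by blast
  then show "(affine_s n i \<circ> affine_s n j) k = (affine_s n j \<circ> affine_s n i) k"
  proof cases
    case 1
    then show ?thesis
      using ij[OF 1] by (simp add: affine_s_eq)
  next
    case 2
    then show ?thesis
      using ij[OF 2] by (simp add: affine_s_eq)
  next
    case 3
    then show ?thesis
      using ji[OF 3] by (simp add: affine_s_eq)
  next
    case 4
    then show ?thesis
      using ji[OF 4] by (simp add: affine_s_eq)
  next
    case 5
    then show ?thesis
      by (simp add: affine_s_eq)
  qed
qed

lemma affine_s_braid:
  assumes "n \<ge> 3"
  shows "affine_s n i \<circ> (affine_s n (i + 1) \<circ> affine_s n i) =
    affine_s n (i + 1) \<circ> (affine_s n i \<circ> affine_s n (i + 1))"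
proof
  fix k
  define j where "j = i + 1"
  have J: "[p = j] (mod int n) \<longleftrightarrow> [p - 1 = i] (mod int n)" for p
    by (simp only: j_def cong_Suc_iff)
  note near = cong_near[OF assms] and eval = affine_s_eq J int_near
  consider "[k = i] (mod int n)" | "[k - 1 = i] (mod int n)" | "[k - 2 = i] (mod int n)"
    | "\<not> [k = i] (mod int n)" "\<not> [k - 1 = i] (mod int n)" "\<not> [k - 2 = i] (mod int n)"
    by blast
  then have "affine_s n i (affine_s n j (affine_s n i k)) = affine_s n j (affine_s n i (affine_s n j k))"
  proof cases
    case 1
    then show ?thesis
      using near[OF 1] by (simp add: eval)
  next
    case 2
    then show ?thesis
      using near[OF 2] by (simp add: eval)
  next
    case 3
    then show ?thesis
      using near[OF 3] by (simp add: eval)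
  next
    case 4
    then show ?thesis
      by (simp add: eval)
  qed
  then show "(affine_s n i \<circ> (affine_s n (i + 1) \<circ> affine_s n i)) k =
    (affine_s n (i + 1) \<circ> (affine_s n i \<circ> affine_s n (i + 1))) k"
    by (simp add: j_def)
qed

section \<open>Two descents at the start of a reduced word\<close>

lemma descent_cong:
  assumes "w \<in> affine_sym n" "[a = b] (mod int n)"
  shows "perm_inv w (a + 1) < perm_inv w a \<longleftrightarrow> perm_inv w (b + 1) < perm_inv w b"
  using quasiperiodic_descent_cong[of "perm_inv w", OF inv_affine_sym(2)[OF n assms(1)] assms(2)] .

text \<open>The reflection for \<open>i\<close> fixes \<open>j\<close> and \<open>j + 1\<close>, so
  the descent at \<open>j\<close> survives the removal of the one at \<open>i\<close>. Both letters
  can be peeled off, and their reflections commute.\<close>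

lemma reduced_word_commute:
  assumes w: "w \<in> affine_sym n" and ij: "i \<in> {0..<int n}" "j \<in> {0..<int n}" "i \<noteq> j"
    and desc: "perm_inv w (i + 1) < perm_inv w i" "perm_inv w (j + 1) < perm_inv w j"
    and far: "\<not> [j = i + 1] (mod int n)" "\<not> [i = j + 1] (mod int n)"
  obtains us where "reduced_word n w (i # j # us)" "reduced_word n w (j # i # us)"
proof -
  have ne: "\<not> [i = j] (mod int n)"
    using ij by (simp add: cong_def)
  have fixed: "affine_s n i j = j" "affine_s n i (j + 1) = j + 1"
    using far ne cong_add_1[OF n, of j i] by (auto simp: affine_s_def cong_sym_eq)
  have w1: "affine_s n i \<circ> w \<in> affine_sym n"
    using affine_s_mem[OF n w] .
  obtain us where us: "reduced_word n (affine_s n j \<circ> (affine_s n i \<circ> w)) us"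
    using ex_reduced_word[OF n affine_s_mem[OF n w1]] by blast
  have "perm_inv (affine_s n i \<circ> w) (j + 1) < perm_inv (affine_s n i \<circ> w) j"
    using desc fixed by (simp add: inv_affine_s_comp[OF n w])
  then have "reduced_word n (affine_s n i \<circ> w) (j # us)"
    using us ij w1 by - (rule reduced_word_Cons[OF n]; assumption)
  then have red: "reduced_word n w (i # j # us)"
    using ij w desc by - (rule reduced_word_Cons[OF n]; assumption)
  moreover have "word_perm n (j # i # us) = word_perm n (i # j # us)"
    using affine_s_commute[OF far ne] by (simp add: o_assoc)
  then have "reduced_word n w (j # i # us)"
    using red by (auto simp: reduced_word_iff[OF n] words_def)
  ultimately show thesis
    by (rule that)
qed

text \<open>The inverse of \<open>w\<close> decreases along \<open>i\<close>, \<open>i + 1\<close>,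
  \<open>i + 2\<close>. Sorting three decreasing values takes three adjacent exchanges, which can
  begin at either end.\<close>

lemma reduced_word_braid:
  assumes w: "w \<in> affine_sym n" and ij: "i \<in> {0..<int n}" "j \<in> {0..<int n}"
    and desc: "perm_inv w (i + 1) < perm_inv w i" "perm_inv w (j + 1) < perm_inv w j"
    and adj: "[j = i + 1] (mod int n)"
  obtains us where "n \<ge> 3" "reduced_word n w (i # j # i # us)" "reduced_word n w (j # i # j # us)"
proof -
  let ?v = "perm_inv w" and ?s = "affine_s n i" and ?t = "affine_s n j"
  have t: "?t = affine_s n (i + 1)"
    using adj by (rule affine_s_cong)
  have "?v (i + 1 + 1) < ?v (i + 1)"
    using desc(2) descent_cong[OF w adj] by simp
  then have v: "?v (i + 2) < ?v (i + 1)"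
    by (simp add: add.assoc)
  \<comment> \<open>For \<open>n = 2\<close> the value of the inverse at \<open>i + 2\<close> is
    that at \<open>i\<close> plus 2, so two adjacent descents cannot both occur.\<close>
  have n3: "n \<ge> 3"
  proof (rule ccontr)
    assume "\<not> n \<ge> 3"
    then have "int n = 2"
      using n by simp
    then show False
      using inv_affine_sym(2)[OF n w, of i] v desc(1) by simp
  qed
  have near: "\<not> [i + 1 = i] (mod int n)" "\<not> [i + 2 = i] (mod int n)" "\<not> [i - 1 = i] (mod int n)"
    "\<not> [i - 2 = i] (mod int n)"
    using cong_near[OF n3, of i i] by simp_all
  have s: "?s i = i + 1" "?s (i + 1) = i" "?s (i + 2) = i + 2"
    and tt: "?t i = i" "?t (i + 1) = i + 2" "?t (i + 2) = i + 1"
    unfolding t affine_s_eq cong_Suc_iff int_near using near by simp_all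
  have w1: "?s \<circ> w \<in> affine_sym n"
    using affine_s_mem[OF n w] .
  have w2: "?t \<circ> (?s \<circ> w) \<in> affine_sym n"
    using affine_s_mem[OF n w1] .
  obtain us where us: "reduced_word n (?s \<circ> (?t \<circ> (?s \<circ> w))) us"
    using ex_reduced_word[OF n affine_s_mem[OF n w2]] by blast
  have "perm_inv (?t \<circ> (?s \<circ> w)) (i + 1) < perm_inv (?t \<circ> (?s \<circ> w)) i"
    using v by (simp add: inv_affine_s_comp[OF n w1] inv_affine_s_comp[OF n w] s tt)
  then have "reduced_word n (?t \<circ> (?s \<circ> w)) (i # us)"
    using us ij w2 by - (rule reduced_word_Cons[OF n]; assumption)
  moreover have "perm_inv (?s \<circ> w) (i + 1 + 1) < perm_inv (?s \<circ> w) (i + 1)"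
    using v desc(1) by (simp add: inv_affine_s_comp[OF n w] s add.assoc)
  then have "perm_inv (?s \<circ> w) (j + 1) < perm_inv (?s \<circ> w) j"
    using descent_cong[OF w1 adj] by simp
  ultimately have "reduced_word n (?s \<circ> w) (j # i # us)"
    using ij w1 by - (rule reduced_word_Cons[OF n]; assumption)
  then have red: "reduced_word n w (i # j # i # us)"
    using ij w desc by - (rule reduced_word_Cons[OF n]; assumption)
  moreover have "word_perm n (j # i # j # us) = word_perm n (i # j # i # us)"
  proof -
    have "?s \<circ> (?t \<circ> ?s) \<circ> word_perm n us = ?t \<circ> (?s \<circ> ?t) \<circ> word_perm n us"
      using affine_s_braid[OF n3, of i] by (simp add: t)
    then show ?thesis
      by (simp add: o_assoc)
  qed
  then have "reduced_word n w (j # i # j # us)"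
    using red ij by (auto simp: reduced_word_iff[OF n] words_def)
  ultimately show thesis
    using n3 that by blast
qed

text \<open>Matsumoto's argument. Words with the same first letter are compared through their tails.
  If the first letters \<open>i\<close> and \<open>j\<close> differ, both are descents, so there are
  reduced words starting with \<open>i\<close> and with \<open>j\<close> that differ by one braid or
  commutation move; each is compared with the given word that has the same first letter.\<close>

lemma cell_reduced_eq:
  assumes "reduced_word n w ws" "reduced_word n w ws'"
  shows "cell n ws = cell n ws'"
  using assms
proof (induction "length ws" arbitrary: w ws ws' rule: less_induct)
  case less
  have w: "w \<in> affine_sym n"
    using less.prems(1) by (rule reduced_word_mem[OF n])
  have len: "length ws = length ws'"
    using less.prems by (simp add: reduced_word_iff[OF n])
  show ?case
  proof (cases ws)
    case Nil
    then show ?thesis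
      using len by simp
  next
    case (Cons i us)
    then obtain j us' where ws': "ws' = j # us'"
      using len by (cases ws') auto
    have same_head: "cell n (k # us1) = cell n (k # us2)"
      if "reduced_word n w (k # us1)" "reduced_word n w (k # us2)" for k us1 us2
    proof -
      have "length (k # us1) = length ws"
        using that less.prems by (simp add: reduced_word_iff[OF n])
      then have "cell n us1 = cell n us2"
        using reduced_word_ConsD(2)[OF n that(1)] reduced_word_ConsD(2)[OF n that(2)]
        by (intro less.hyps) auto
      then show ?thesis
        by simp
    qed
    have i: "reduced_word n w (i # us)" and j: "reduced_word n w (j # us')"
      using less.prems Cons ws' by simp_all
    note di = reduced_word_ConsD[OF n i] and dj = reduced_word_ConsD[OF n j]
    consider "i = j" | "[j = i + 1] (mod int n)" | "[i = j + 1] (mod int n)"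
      | "i \<noteq> j" "\<not> [j = i + 1] (mod int n)" "\<not> [i = j + 1] (mod int n)"
      by blast
    then have "cell n (i # us) = cell n (j # us')"
    proof cases
      case 1
      then show ?thesis
        using same_head i j by blast
    next
      case 2
      then obtain vs where "n \<ge> 3" "reduced_word n w (i # j # i # vs)"
          "reduced_word n w (j # i # j # vs)"
        using reduced_word_braid[OF w di(3) dj(3) di(1) dj(1)] by blast
      then show ?thesis
        using same_head[OF i] same_head[OF j] cell_braid[OF _ 2] by metis
    next
      case 3
      then obtain vs where "n \<ge> 3" "reduced_word n w (j # i # j # vs)"
          "reduced_word n w (i # j # i # vs)"
        using reduced_word_braid[OF w dj(3) di(3) dj(1) di(1)] by blast
      then show ?thesis
        using same_head[OF i] same_head[OF j] cell_braid[OF _ 3] by metis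
    next
      case 4
      then obtain vs where "reduced_word n w (i # j # vs)" "reduced_word n w (j # i # vs)"
        using reduced_word_commute[OF w di(3) dj(3) _ di(1) dj(1)] by blast
      then show ?thesis
        using same_head[OF i] same_head[OF j] cell_commute[OF 4(2,3)] by metis
    qed
    then show ?thesis
      using Cons ws' by simp
  qed
qed

text \<open>If \<open>i\<close> is a descent of the inverse of \<open>w\<close>, the cell also comes
  from a reduced word starting with \<open>i\<close>, the two parameters for \<open>i\<close> add
  up, and the cell stays the same. Otherwise prepending \<open>i\<close> keeps the word reduced.
  This is multiplication in the 0-Hecke monoid.\<close>

lemma chev_reduced:
  assumes "reduced_word n w ws" "x \<in> cell n ws" "a > 0" "i \<in> {0..<int n}"
  shows "\<exists>w' ws'. reduced_word n w' ws' \<and> chev n i a x \<in> cell n ws'"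
proof (cases "perm_inv w (i + 1) < perm_inv w i")
  case True
  have w: "w \<in> affine_sym n"
    using assms(1) by (rule reduced_word_mem[OF n])
  obtain us where "reduced_word n (affine_s n i \<circ> w) us"
    using ex_reduced_word[OF n affine_s_mem[OF n w]] by blast
  then have red: "reduced_word n w (i # us)"
    using True assms(4) w by - (rule reduced_word_Cons[OF n]; assumption)
  then have "x \<in> cell n (i # us)"
    using assms(2) cell_reduced_eq[OF assms(1)] by blast
  then obtain b y where y: "x = chev n i b y" "b > 0" "y \<in> cell n us"
    by auto
  then have "chev n i a x = chev n i (a + b) y" "a + b > 0"
    using assms(3) by (simp_all add: chev_add)
  then have "chev n i a x \<in> cell n (i # us)"
    using y(3) by auto
  then show ?thesis
    using red by blast
next
  case False
  have w: "w \<in> affine_sym n"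
    using assms(1) by (rule reduced_word_mem[OF n])
  then have "perm_inv w i < perm_inv w (i + 1)"
    using False inv_neq[OF n w, of i] by simp
  then have "perm_inv (affine_s n i \<circ> w) (i + 1) < perm_inv (affine_s n i \<circ> w) i"
    by (simp add: inv_affine_s_comp[OF n w] affine_s_at[OF n])
  then have "reduced_word n (affine_s n i \<circ> w) (i # ws)"
    using assms affine_s_mem[OF n w]
    by - (rule reduced_word_Cons[OF n], simp_all only: affine_s_comp_comp[OF n])
  moreover have "chev n i a x \<in> cell n (i # ws)"
    using assms(2,3) by auto
  ultimately show ?thesis
    by blast
qed

lemma ex_reduced_cell:
  assumes "ws \<in> words n" "x \<in> cell n ws"
  shows "\<exists>w' ws'. reduced_word n w' ws' \<and> x \<in> cell n ws'"
  using assms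
proof (induction ws arbitrary: x)
  case Nil
  then show ?case
    by (intro exI[of _ "word_perm n []"] exI[of _ "[]"]) (simp add: reduced_word_def words_def del: word_perm_simps)
next
  case (Cons i ws)
  then obtain a y where "x = chev n i a y" "a > 0" "y \<in> cell n ws" "i \<in> {0..<int n}" "ws \<in> words n"
    by (auto simp: words_def)
  then show ?case
    using Cons.IH chev_reduced by blast
qed

end

section \<open>Recovering the affine permutation from the row spaces\<close>

text \<open>Only finite combinations are allowed, although infinitely many rows precede row
  \<open>p\<close>.\<close>

inductive rowspan :: "(int \<Rightarrow> int \<Rightarrow> real) \<Rightarrow> int \<Rightarrow> (int \<Rightarrow> real) \<Rightarrow> bool" for x p where
  zero: "rowspan x p (\<lambda>_. 0)"
| add: "rowspan x p f \<Longrightarrow> k \<le> p \<Longrightarrow> rowspan x p (\<lambda>q. f q + c * x k q)"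

definition lead :: "(int \<Rightarrow> real) \<Rightarrow> int \<Rightarrow> bool" where
  "lead f m \<longleftrightarrow> f m \<noteq> 0 \<and> (\<forall>q > m. f q = 0)"

text \<open>An infinite substitute for the corner ranks that identify the Bruhat cell of a finite
  matrix.\<close>

definition leads :: "(int \<Rightarrow> int \<Rightarrow> real) \<Rightarrow> int \<Rightarrow> int set" where
  "leads x p = {m. \<exists>f. rowspan x p f \<and> lead f m}"

lemma rowspan_row: "k \<le> p \<Longrightarrow> rowspan x p (x k)"
  using rowspan.add[OF rowspan.zero, of k p x 1] by simp

lemma rowspan_add:
  assumes "rowspan x p f" "rowspan x p g"
  shows "rowspan x p (\<lambda>q. f q + a * g q)"
  using assms(2)
proof induction
  case zero
  then show ?case
    using assms(1) by simp
next
  case (add g k c)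
  then show ?case
    using rowspan.add[OF add.IH add.hyps(2), of "a * c"] by (simp add: algebra_simps)
qed

lemma rowspan_scale: "rowspan x p g \<Longrightarrow> rowspan x p (\<lambda>q. a * g q)"
  using rowspan_add[OF rowspan.zero, of x p g a] by simp

lemma rowspan_trans:
  assumes "rowspan x p f" "\<And>k. k \<le> p \<Longrightarrow> rowspan y p' (x k)"
  shows "rowspan y p' f"
  using assms(1) by induction (auto intro: rowspan.zero rowspan_add assms(2))

lemma rowspan_mono: "rowspan x p f \<Longrightarrow> p \<le> p' \<Longrightarrow> rowspan x p' f"
  by (rule rowspan_trans) (auto intro: rowspan_row)

lemma leads_mono: "p \<le> p' \<Longrightarrow> leads x p \<subseteq> leads x p'"
  by (auto simp: leads_def intro: rowspan_mono)

lemma rowspan_split: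
  assumes "rowspan x p f"
  shows "\<exists>c g. rowspan x (p - 1) g \<and> f = (\<lambda>q. g q + c * x p q)"
  using assms
proof induction
  case zero
  show ?case
    by (intro exI[of _ 0] exI[of _ "\<lambda>_. 0"]) (simp add: rowspan.zero)
next
  case (add f k c)
  then obtain d g where g: "rowspan x (p - 1) g" "f = (\<lambda>q. g q + d * x p q)"
    by blast
  show ?case
  proof (cases "k = p")
    case True
    then show ?thesis
      using g by (intro exI[of _ "d + c"] exI[of _ g]) (simp add: algebra_simps)
  next
    case False
    then have "rowspan x (p - 1) (\<lambda>q. g q + c * x k q)"
      using add.hyps g(1) by (intro rowspan.add) auto
    then show ?thesis
      using g(2) by (intro exI[of _ d] exI[of _ "\<lambda>q. g q + c * x k q"]) (simp add: algebra_simps)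
  qed
qed

lemma lead_combine:
  assumes "lead f m" "lead g m'" "m < m'" "b \<noteq> 0"
  shows "lead (\<lambda>q. a * f q + b * g q) m'"
  using assms by (auto simp: lead_def)

text \<open>Row \<open>p\<close> enlarges the span by at most one dimension. Given two new leads,
  the two vectors could be combined so that row \<open>p\<close> cancels; the combination lies in
  the smaller span and still has the larger lead.\<close>

lemma leads_new_unique:
  assumes "m \<in> leads x p - leads x (p - 1)" "m' \<in> leads x p - leads x (p - 1)"
  shows "m = m'"
proof -
  have False if new: "m \<in> leads x p - leads x (p - 1)" "m' \<in> leads x p - leads x (p - 1)"
    and less: "m < m'" for m m'
  proof -
    obtain f f' where f: "rowspan x p f" "lead f m" and f': "rowspan x p f'" "lead f' m'"
      using new by (auto simp: leads_def)
    obtain c g where g: "rowspan x (p - 1) g" "f = (\<lambda>q. g q + c * x p q)"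
      using rowspan_split[OF f(1)] by blast
    obtain c' g' where g': "rowspan x (p - 1) g'" "f' = (\<lambda>q. g' q + c' * x p q)"
      using rowspan_split[OF f'(1)] by blast
    have "c \<noteq> 0"
      using new(1) f(2) g by (auto simp: leads_def)
    have "rowspan x (p - 1) (\<lambda>q. c * g' q + (- c') * g q)"
      using g(1) g'(1) by (intro rowspan_add rowspan_scale)
    also have "(\<lambda>q. c * g' q + (- c') * g q) = (\<lambda>q. (- c') * f q + c * f' q)"
      using g(2) g'(2) by (simp add: algebra_simps)
    finally have "m' \<in> leads x (p - 1)"
      using lead_combine[OF f(2) f'(2) less \<open>c \<noteq> 0\<close>, of "- c'"] unfolding leads_def by blast
    then show False
      using new(2) by blast
  qed
  then show ?thesis
    using assms by (meson linorder_less_linear)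
qed

lemma leads_id: "leads id_unfolded p = {..p}"
proof (intro equalityI subsetI)
  fix m assume "m \<in> leads id_unfolded p"
  then obtain f where f: "rowspan id_unfolded p f" "f m \<noteq> 0"
    by (auto simp: leads_def lead_def)
  have "f q = 0" if "q > p" for q
    using f(1) that by induction (auto simp: id_unfolded_def)
  then show "m \<in> {..p}"
    using f(2) by force
next
  fix m assume "m \<in> {..p}"
  then have "rowspan id_unfolded p (id_unfolded m)"
    by (intro rowspan_row) simp
  then show "m \<in> leads id_unfolded p"
    by (auto simp: leads_def lead_def id_unfolded_def intro!: exI[of _ "id_unfolded m"])
qed

context
  fixes n :: nat
  assumes n: "n \<ge> 2"
begin

text \<open>Row \<open>k\<close> changes only for \<open>k\<close> congruent to \<open>i\<close>;
  such a \<open>k \<le> p\<close> is not \<open>p\<close>, so row \<open>k + 1\<close> belongs to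
  the span too. The converse uses the inverse operation with \<open>- a\<close>.\<close>

lemma rowspan_chev:
  assumes "\<not> [p = i] (mod int n)"
  shows "rowspan (chev n i a y) p f \<longleftrightarrow> rowspan y p f"
proof -
  have *: "rowspan y p (chev n i a y k)" if "k \<le> p" for k a y
  proof (cases "[k = i] (mod int n)")
    case True
    then have "k + 1 \<le> p"
      using that assms by (cases "k = p") auto
    then have "rowspan y p (\<lambda>q. y k q + a * y (k + 1) q)"
      using that by (intro rowspan_add rowspan_row)
    then show ?thesis
      using True by (simp add: row_add_def[abs_def])
  next
    case False
    then show ?thesis
      using rowspan_row[OF that, of y] by (simp add: row_add_def[abs_def])
  qed
  have "chev n i (- a) (chev n i a y) = y"
    by (simp add: chev_add[OF n] row_add_def fun_eq_iff)
  then have "rowspan (chev n i a y) p (y k)" if "k \<le> p" for k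
    using *[OF that, of "chev n i a y" "- a"] by simp
  then show ?thesis
    using * by (blast intro: rowspan_trans)
qed

lemma affine_s_image_atMost:
  assumes "\<not> [p = i] (mod int n)"
  shows "affine_s n i ` {..p} = {..p}"
proof -
  have "affine_s n i k \<le> p \<longleftrightarrow> k \<le> p" for k
  proof (cases rule: affine_s_cases[OF n, of k i])
    case 1
    then show ?thesis using assms by (cases "k = p") auto
  next
    case 2
    then show ?thesis using assms by (cases "k - 1 = p") auto
  qed auto
  then show ?thesis
    by (auto simp: set_eq_iff affine_s_image_iff[OF n])
qed

text \<open>
  Adding a multiple of row \<open>p + 1\<close> to row \<open>p\<close> exchanges the two new leads \<open>u p < u (p + 1)\<close>
  of the rows \<open>p\<close> and \<open>p + 1\<close>.
\<close>

lemma leads_chev: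
  assumes u: "inj u" "\<And>k. u (k + int n) = u k + int n" "u i < u (i + 1)"
    and y: "\<And>p. leads y p = u ` {..p}" and "a > 0"
  shows "leads (chev n i a y) p = (u \<circ> affine_s n i) ` {..p}"
proof -
  let ?x = "chev n i a y"
  have other: "leads ?x p = u ` {..p}" if "\<not> [p = i] (mod int n)" for p
    using that y[of p] by (simp add: leads_def rowspan_chev)
  show ?thesis
  proof (cases "[p = i] (mod int n)")
    case False
    then show ?thesis
      unfolding image_comp[symmetric] affine_s_image_atMost[OF False] by (rule other)
  next
    case True
    then have p1: "\<not> [p - 1 = i] (mod int n)" "\<not> [p + 1 = i] (mod int n)"
      using not_cong_Suc[OF n, of p i] not_cong_Suc[OF n, of "p - 1" i] by auto
    have sp: "affine_s n i p = p + 1"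
      using True by (simp add: affine_s_def)
    have up: "u p < u (p + 1)"
      using quasiperiodic_descent_cong[of u, OF u(2) True] u(3) inj_eq[OF u(1), of p "p + 1"] by simp
    have ins: "{..p} = insert p {..p - 1}" "{..p + 1} = insert (p + 1) {..p}"
      by auto
    have x1: "leads ?x (p - 1) = u ` {..p - 1}" and x2: "leads ?x (p + 1) = u ` {..p + 1}"
      by (fact other[OF p1(1)], fact other[OF p1(2)])
    have notin: "u p \<notin> u ` {..p - 1}" "u (p + 1) \<notin> u ` {..p - 1}" "u (p + 1) \<notin> u ` {..p}"
      using u(1) by (auto simp: inj_image_mem_iff)
    have new: "u (p + 1) \<in> leads ?x p"
    proof -
      have "u p \<in> leads y p" "u (p + 1) \<in> leads y (p + 1)"
        using y by auto
      then obtain f g where f: "rowspan y p f" "lead f (u p)"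
        and g: "rowspan y (p + 1) g" "lead g (u (p + 1))"
        by (auto simp: leads_def)
      obtain c f0 where f0: "rowspan y (p - 1) f0" "f = (\<lambda>q. f0 q + c * y p q)"
        using rowspan_split[OF f(1)] by blast
      obtain d g1 where g1: "rowspan y p g1" "g = (\<lambda>q. g1 q + d * y (p + 1) q)"
        using rowspan_split[OF g(1)] by auto
      obtain e g0 where g0: "rowspan y (p - 1) g0" "g1 = (\<lambda>q. g0 q + e * y p q)"
        using rowspan_split[OF g1(1)] by blast
      have "c \<noteq> 0"
      proof
        assume "c = 0"
        then have "u p \<in> leads y (p - 1)"
          using f f0 by (auto simp: leads_def)
        then show False
          using y notin by simp
      qed
      have "d \<noteq> 0"
      proof
        assume "d = 0"
        then have "u (p + 1) \<in> leads y p"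
          using g g1 by (auto simp: leads_def)
        then show False
          using y notin by simp
      qed
      \<comment> \<open>Chosen so that in \<open>r * f + (a / d) * g\<close> row \<open>p\<close>
        has coefficient 1 and row \<open>p + 1\<close> has coefficient \<open>a\<close>: modulo
        earlier rows this is row \<open>p\<close> of the new matrix. As \<open>a / d\<close> is
        nonzero, its lead is that of \<open>g\<close>.\<close>
      define r where "r = (1 - a * e / d) / c"
      have rc: "r * c + a / d * e = 1"
        using \<open>c \<noteq> 0\<close> by (simp add: r_def)
      have "rowspan y (p - 1) (\<lambda>q. r * f0 q + (a / d) * g0 q)"
        using f0(1) g0(1) by (intro rowspan_add rowspan_scale)
      then have "rowspan ?x (p - 1) (\<lambda>q. r * f0 q + (a / d) * g0 q)"
        by (rule iffD2[OF rowspan_chev[OF p1(1)]])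
      then have "rowspan ?x p (\<lambda>q. r * f0 q + (a / d) * g0 q)"
        by (rule rowspan_mono) simp
      then have "rowspan ?x p (\<lambda>q. (r * f0 q + (a / d) * g0 q) + 1 * ?x p q)"
        by (rule rowspan.add) simp
      also have "(\<lambda>q. (r * f0 q + (a / d) * g0 q) + 1 * ?x p q) = (\<lambda>q. r * f q + (a / d) * g q)"
      proof
        fix q
        have "r * f q + (a / d) * g q = r * f0 q + a / d * g0 q + (r * c + a / d * e) * y p q + a * y (p + 1) q"
          using \<open>d \<noteq> 0\<close> by (simp add: f0(2) g1(2) g0(2) algebra_simps)
        also have "\<dots> = (r * f0 q + (a / d) * g0 q) + 1 * ?x p q"
          unfolding rc using True by (simp add: row_add_def)
        finally show "(r * f0 q + (a / d) * g0 q) + 1 * ?x p q = r * f q + (a / d) * g q" ..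
      qed
      finally show ?thesis
        using lead_combine[OF f(2) g(2) up, of "a / d" r] \<open>a > 0\<close> \<open>d \<noteq> 0\<close> by (auto simp: leads_def)
    qed
    \<comment> \<open>The span up to \<open>p\<close> has at most one lead that is absent at
      \<open>p - 1\<close>, and \<open>u (p + 1)\<close> is that lead.\<close>
    have "u p \<notin> leads ?x p"
      using leads_new_unique[of "u p" ?x p "u (p + 1)"] new notin up x1 by auto
    moreover have "leads ?x p \<subseteq> insert (u (p + 1)) (insert (u p) (u ` {..p - 1}))"
      using leads_mono[of p "p + 1" ?x] unfolding x2 ins by auto
    moreover have "u ` {..p - 1} \<subseteq> leads ?x p"
      using leads_mono[of "p - 1" p ?x] x1 by simp
    ultimately have "leads ?x p = insert (u (p + 1)) (u ` {..p - 1})"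
      using new by auto
    also have "\<dots> = (u \<circ> affine_s n i) ` {..p}"
      unfolding ins image_comp[symmetric] image_insert affine_s_image_atMost[OF p1(1)] o_apply sp ..
    finally show ?thesis .
  qed
qed

text \<open>Removing the first letter \<open>i\<close> of a reduced word leaves a permutation whose
  inverse increases at \<open>i\<close>, as \<open>leads_chev\<close> requires.\<close>

lemma leads_cell:
  assumes "reduced_word n w ws" "x \<in> cell n ws"
  shows "leads x p = perm_inv w ` {..p}"
  using assms
proof (induction ws arbitrary: w x p)
  case Nil
  then have "w = (\<lambda>k. k)"
    by (simp add: reduced_word_def id_def)
  then have "perm_inv w = (\<lambda>k. k)"
    using inv_id by (simp add: id_def)
  then show ?case
    using Nil by (simp add: leads_id)
next
  case (Cons i us)
  have w: "w \<in> affine_sym n"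
    using Cons.prems(1) by (rule reduced_word_mem[OF n])
  note red = reduced_word_ConsD[OF n Cons.prems(1)]
  obtain a y where y: "x = chev n i a y" "a > 0" "y \<in> cell n us"
    using Cons.prems(2) by auto
  let ?u = "perm_inv (affine_s n i \<circ> w)"
  have u: "?u = perm_inv w \<circ> affine_s n i"
    by (rule inv_affine_s_comp[OF n w])
  have "leads (chev n i a y) p = (?u \<circ> affine_s n i) ` {..p}"
  proof (rule leads_chev)
    show "inj ?u" "?u (k + int n) = ?u k + int n" for k
      using inv_affine_sym[OF n affine_s_mem[OF n w]] by blast+
    show "?u i < ?u (i + 1)"
      unfolding u using red(1) by (simp add: affine_s_at[OF n])
    show "leads y p = ?u ` {..p}" for p
      using Cons.IH[OF red(2) y(3)] .
  qed fact
  also have "?u \<circ> affine_s n i = perm_inv w"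
    unfolding u by (simp add: fun_eq_iff affine_s_invol[OF n])
  finally show ?case
    using y(1) by simp
qed

text \<open>The value of the inverse at \<open>p\<close> is the single point by which its images of
  \<open>{..p}\<close> and \<open>{..p - 1}\<close> differ, so the leads determine the inverse and
  hence the permutation.\<close>

lemma cell_disjoint:
  assumes "reduced_word n w ws" "x \<in> cell n ws" "reduced_word n w' ws'" "x \<in> cell n ws'"
  shows "w = w'"
proof -
  have eq: "perm_inv w ` {..p} = perm_inv w' ` {..p}" for p
    using leads_cell[OF assms(1,2)] leads_cell[OF assms(3,4)] by simp
  have w: "w \<in> affine_sym n" "w' \<in> affine_sym n"
    using assms reduced_word_mem[OF n] by blast+
  have single: "{v p} = v ` {..p} - v ` {..p - 1}" if "inj v" for v :: "int \<Rightarrow> int" and p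
  proof -
    have "v ` {..p} - v ` {..p - 1} = v ` ({..p} - {..p - 1})"
      using that by (simp add: image_set_diff)
    moreover have "{..p} - {..p - 1} = {p}"
      by auto
    ultimately show ?thesis
      by simp
  qed
  have "{perm_inv w p} = {perm_inv w' p}" for p
    unfolding single[OF inv_affine_sym(1)[OF n w(1)]] single[OF inv_affine_sym(1)[OF n w(2)]] eq ..
  then have "perm_inv w = perm_inv w'"
    by (simp add: fun_eq_iff)
  moreover have "bij w" "bij w'"
    using w by (auto simp: affine_sym_def)
  ultimately show ?thesis
    by (metis inv_inv_eq)
qed

end

section \<open>Factoring off a Chevalley generator\<close>

text \<open>\<open>Max\<close> is meaningful only for a finite nonempty support, which
  \<open>unitriangular\<close> and \<open>banded\<close> provide.\<close>

definition last_col :: "(int \<Rightarrow> int \<Rightarrow> real) \<Rightarrow> int \<Rightarrow> int" where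
  "last_col x p = Max {q. x p q \<noteq> 0}"

definition periodic_mat :: "nat \<Rightarrow> (int \<Rightarrow> int \<Rightarrow> real) \<Rightarrow> bool" where
  "periodic_mat n x \<longleftrightarrow> (\<forall>p q. x (p + int n) (q + int n) = x p q)"

definition unitriangular :: "(int \<Rightarrow> int \<Rightarrow> real) \<Rightarrow> bool" where
  "unitriangular x \<longleftrightarrow> (\<forall>p q. q < p \<longrightarrow> x p q = 0) \<and> (\<forall>p. x p p = 1)"

text \<open>For unfoldings this says that all folded entries are Laurent polynomials, see
  \<open>laurent_polynomial_iff_banded\<close>. Only the right side is bounded, since Laurent series
  are already finite on the left.\<close>

definition banded :: "(int \<Rightarrow> int \<Rightarrow> real) \<Rightarrow> bool" where
  "banded x \<longleftrightarrow> (\<exists>M. \<forall>p q. p + M < q \<longrightarrow> x p q = 0)"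

text \<open>The termination measure of the factorization. By \<open>last_col_props\<close> the
  differences are nonnegative for the matrices in question, so \<open>nat\<close> loses nothing, and
  they are periodic in \<open>p\<close>, so one period suffices.\<close>

definition excess :: "nat \<Rightarrow> (int \<Rightarrow> int \<Rightarrow> real) \<Rightarrow> nat" where
  "excess n x = (\<Sum>p = 1..int n. nat (last_col x p - p))"

section \<open>The staircase of last nonzero entries\<close>

lemma tnn_entry: "tnn x \<Longrightarrow> 0 \<le> x p q"
proof -
  assume tnn: "tnn x"
  have "strict_mono_on {..<1::nat} (\<lambda>_. r :: int)" for r
    by (rule strict_mono_onI) simp
  then have "0 \<le> finite_minor x 1 (\<lambda>_. p) (\<lambda>_. q)"
    by (intro tnnD[OF tnn])
  then show ?thesis
    by (simp add: finite_minor_def det_single)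
qed

lemma tnn_minor2:
  assumes "tnn x" "p < p'" "q < q'"
  shows "x p q' * x p' q \<le> x p q * x p' q'"
proof -
  define r where "r = (\<lambda>k::nat. if k = 0 then p else p')"
  define c where "c = (\<lambda>k::nat. if k = 0 then q else q')"
  have "0 \<le> finite_minor x 2 r c"
    using assms by (intro tnnD) (auto simp: strict_mono_on_def r_def c_def)
  also have "\<dots> = x p q * x p' q' - x p q' * x p' q"
    unfolding finite_minor_array
    by (subst array_det_expand_row[of 0])
      (simp_all add: array_cof_def array_det_def det_single r_def c_def numeral_2_eq_2)
  finally show ?thesis
    by simp
qed

lemma last_col_props:
  assumes "unitriangular x" "banded x"
  shows "x p (last_col x p) \<noteq> 0" "p \<le> last_col x p" "\<And>q. last_col x p < q \<Longrightarrow> x p q = 0"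
proof -
  obtain M where M: "\<And>p q. p + M < q \<Longrightarrow> x p q = 0"
    using assms(2) by (auto simp: banded_def)
  have "{q. x p q \<noteq> 0} \<subseteq> {p..p + M}"
  proof
    fix q assume "q \<in> {q. x p q \<noteq> 0}"
    then have "\<not> p + M < q" "\<not> q < p"
      using M[of p q] assms(1) by (auto simp: unitriangular_def)
    then show "q \<in> {p..p + M}"
      by simp
  qed
  then have fin: "finite {q. x p q \<noteq> 0}"
    by (rule finite_subset) simp
  have p: "p \<in> {q. x p q \<noteq> 0}"
    using assms(1) by (simp add: unitriangular_def)
  show "x p (last_col x p) \<noteq> 0"
    using Max_in[OF fin] p unfolding last_col_def by blast
  show "p \<le> last_col x p"
    unfolding last_col_def using fin p by (rule Max_ge)
  show "x p q = 0" if "last_col x p < q" for q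
    using Max_ge[OF fin, of q] that unfolding last_col_def by force
qed

lemma last_col_le:
  assumes "unitriangular x" "banded x" "\<And>q. m < q \<Longrightarrow> x p q = 0"
  shows "last_col x p \<le> m"
  using last_col_props(1)[OF assms(1,2), of p] assms(3) by force

text \<open>If row \<open>p\<close> ends beyond column \<open>p + 1\<close>, consider the 2 by 2
  minor on rows \<open>p\<close>, \<open>p + 1\<close> and on column \<open>p + 1\<close> and the
  last column of row \<open>p\<close>. Its lower left entry is 1, so its nonnegativity forces row
  \<open>p + 1\<close> to be nonzero in that last column.\<close>

lemma last_col_step:
  assumes "tnn x" "unitriangular x" "banded x"
  shows "last_col x p \<le> last_col x (p + 1)"
proof (cases "last_col x p \<le> p + 1")
  case True
  then show ?thesis
    using last_col_props(2)[OF assms(2,3), of "p + 1"] by simp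
next
  case False
  let ?m = "last_col x p"
  have "x p ?m * x (p + 1) (p + 1) \<le> x p (p + 1) * x (p + 1) ?m"
    using False by (intro tnn_minor2[OF assms(1)]) auto
  moreover have "x p ?m > 0"
    using tnn_entry[OF assms(1), of p ?m] last_col_props(1)[OF assms(2,3), of p] by simp
  ultimately have "x (p + 1) ?m \<noteq> 0"
    using assms(2) by (auto simp: unitriangular_def)
  then show ?thesis
    using last_col_props(3)[OF assms(2,3), of "p + 1" ?m] by force
qed

lemma mono_int_step:
  fixes f :: "int \<Rightarrow> int"
  assumes "\<And>k. f k \<le> f (k + 1)"
  shows "mono f"
proof (rule monoI)
  fix a b :: int assume "a \<le> b"
  then show "f a \<le> f b"
    by (induction rule: int_ge_induct) (use assms in \<open>auto intro: order_trans\<close>)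
qed

lemma last_col_periodic:
  assumes "periodic_mat n x" "unitriangular x" "banded x"
  shows "last_col x (p + int n) = last_col x p + int n"
proof (rule antisym)
  have per: "x (p + int n) q = x p (q - int n)" for p q
    using assms(1)[unfolded periodic_mat_def, rule_format, of p "q - int n"] by simp
  show "last_col x (p + int n) \<le> last_col x p + int n"
    by (intro last_col_le[OF assms(2,3)]) (simp add: per last_col_props(3)[OF assms(2,3)])
  have "last_col x p \<le> last_col x (p + int n) - int n"
  proof (rule last_col_le[OF assms(2,3)])
    fix q assume "last_col x (p + int n) - int n < q"
    then show "x p q = 0"
      using per[of p "q + int n"] last_col_props(3)[OF assms(2,3), of "p + int n"
          "q + int n"] by simp
  qed
  then show "last_col x p + int n \<le> last_col x (p + int n)"
    by simp
qed

lemma unitriangular_row_add: "unitriangular x \<Longrightarrow> unitriangular (row_add S a x)"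
  by (auto simp: unitriangular_def row_add_def)

lemma banded_row_add:
  assumes "banded x"
  shows "banded (row_add S a x)"
proof -
  obtain M where "\<And>p q. p + M < q \<Longrightarrow> x p q = 0"
    using assms by (auto simp: banded_def)
  then have "row_add S a x p q = 0" if "p + (\<bar>M\<bar> + 1) < q" for p q
    using that by (auto simp: row_add_def)
  then show ?thesis
    unfolding banded_def by blast
qed

text \<open>
  The generator is found at the first row \<open>i\<close> of a block of rows ending in the same column.
  If there is no such block, row \<open>p\<close> ends in column \<open>p + c\<close> for a fixed \<open>c\<close>, which is excluded by
  \<open>rigid\<close> unless \<open>c = 0\<close>.
\<close>

lemma factor_chev:
  assumes n: "n \<ge> 2" and tnn: "tnn x" and per: "periodic_mat n x"
    and uni: "unitriangular x" and band: "banded x"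
    and rigid: "\<And>c. (\<And>p. x p (p + c) \<noteq> 0) \<Longrightarrow> (\<And>p q. p + c < q \<Longrightarrow> x p q = 0) \<Longrightarrow> c \<le> 0"
    and "x \<noteq> id_unfolded"
  shows "\<exists>i a. i \<in> {0..<int n} \<and> 0 < a \<and> tnn (chev n i (- a) x) \<and>
    excess n (chev n i (- a) x) < excess n x"
proof -
  let ?l = "last_col x"
  note l = last_col_props[OF uni band]
  have pos: "x p (?l p) > 0" for p
    using tnn_entry[OF tnn, of p "?l p"] l(1)[of p] by simp
  have l_mono: "mono ?l"
    using last_col_step[OF tnn uni band] by (rule mono_int_step)
  note l_per = last_col_periodic[OF per uni band]
  have "\<exists>p. ?l p = ?l (p + 1)"
  proof (rule ccontr)
    assume "\<not> ?thesis"
    then have "?l p < ?l (p + 1)" for p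
      using last_col_step[OF tnn uni band, of p] by (metis order_less_le)
    then have eq: "?l p = p + ?l 0" for p
      using l_per n by (intro quasiperiodic_increasing[where n = n]) auto
    have "?l 0 \<le> 0"
      using l(1,3) eq by (intro rigid) metis+
    then have "?l p = p" for p
      using eq[of p] l(2)[of 0] by simp
    then have "x = id_unfolded"
      using l(3) uni by (auto simp: fun_eq_iff id_unfolded_def unitriangular_def linorder_neq_iff)
    then show False
      using \<open>x \<noteq> id_unfolded\<close> by contradiction
  qed
  then obtain p where p: "?l p = ?l (p + 1)"
    by blast
  \<comment> \<open>The window reaches back one full period. Since \<open>?l (p - int n)\<close> is
    \<open>?l p - int n\<close>, the block of \<open>p\<close> starts strictly inside it, so the
    minimum of \<open>Q\<close> really is the first row of the block.\<close>
  define Q where "Q = {q \<in> {p - int n..p}. ?l q = ?l p}"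
  define i0 where "i0 = Min Q"
  have "Q \<subseteq> {p - int n..p}"
    by (auto simp: Q_def)
  then have Q: "finite Q" "p \<in> Q"
    by (auto simp: Q_def finite_subset)
  then have i0: "i0 \<in> Q" "\<And>q. q \<in> Q \<Longrightarrow> i0 \<le> q"
    unfolding i0_def by (auto intro: Min_in)
  then have i0_eq: "?l i0 = ?l p" "i0 \<le> p" "p - int n \<le> i0"
    by (auto simp: Q_def)
  have "i0 \<noteq> p - int n"
    using i0_eq l_per[of "p - int n"] n by auto
  then have "i0 - 1 \<in> Q" if "?l (i0 - 1) = ?l p"
    using that i0_eq by (auto simp: Q_def)
  then have "?l (i0 - 1) \<noteq> ?l p"
    using i0(2) by force
  then have jump0: "?l (i0 - 1) < ?l i0" "?l (i0 + 1) = ?l i0"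
    using monoD[OF l_mono, of "i0 - 1" i0] monoD[OF l_mono, of i0 "i0 + 1"]
      monoD[OF l_mono, of "i0 + 1" "p + 1"] i0_eq p by auto
  define i where "i = i0 mod int n"
  have i: "i \<in> {0..<int n}" "[i0 = i] (mod int n)"
    using n by (auto simp: i_def cong_def)
  define a where "a = x i0 (?l i0) / x (i0 + 1) (?l i0)"
  have l_next: "?l (k + int n + 1) = ?l (k + 1) + int n"
      "?l (k + int n - 1) = ?l (k - 1) + int n" for k
    using l_per[of "k + 1"] l_per[of "k - 1"] by (simp_all add: algebra_simps)
  have x_next: "x (k + int n + 1) (q + int n) = x (k + 1) q" for k q
    using per[unfolded periodic_mat_def, rule_format, of "k + 1" q] by (simp add: algebra_simps)
  have cls: "[k = i0] (mod int n)" if "[k = i] (mod int n)" for k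
    using that i(2) by (metis cong_sym cong_trans)
  have jump: "?l (k - 1) < ?l k \<and> ?l (k + 1) = ?l k" if "[k = i] (mod int n)" for k
    using periodic_cong[of "\<lambda>k. ?l (k - 1) < ?l k \<and> ?l (k + 1) = ?l k", OF _ cls[OF that]] jump0
    by (simp add: l_next l_per)
  \<comment> \<open>By periodicity the quotient is the same in all rows of the class, so a single
    parameter eliminates all of them.\<close>
  have a: "a = x k (?l k) / x (k + 1) (?l k)" if "[k = i] (mod int n)" for k
    using periodic_cong[of "\<lambda>k. x k (?l k) / x (k + 1) (?l k)", OF _ cls[OF that]] per
    unfolding a_def by (simp add: l_per x_next periodic_mat_def)
  have a_pos: "a > 0"
    unfolding a_def using pos[of i0] pos[of "i0 + 1"] jump0 by simp
  let ?y = "chev n i (- a) x"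
  have tnn_y: "tnn ?y"
    by (rule tnn_row_eliminate[where l = ?l])
      (use tnn pos l(3) l_mono jump a not_cong_Suc[OF n] in auto)
  have y_zero: "?y k q = 0" if "?l k < q" for k q
    using that l(3)[of k q] l(3)[of "k + 1" q] jump[of k] by (auto simp: row_add_def)
  have y_uni: "unitriangular ?y" and y_band: "banded ?y"
    by (rule unitriangular_row_add[OF uni], rule banded_row_add[OF band])
  have le: "last_col ?y k \<le> ?l k" for k
    using y_zero by (rule last_col_le[OF y_uni y_band])
  have "?y k (?l k) = 0" if "[k = i] (mod int n)" for k
    using that a[OF that] jump[OF that] pos[of "k + 1"] by (simp add: row_add_def)
  then have less: "last_col ?y k < ?l k" if "[k = i] (mod int n)" for k
    using that le[of k] last_col_props(1)[OF y_uni y_band, of k] by (metis order_le_less)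
  \<comment> \<open>The representative of the class of \<open>i\<close> between 1 and
    \<open>n\<close>, the range of the sum in \<open>excess\<close>; \<open>i\<close> itself may be
    0.\<close>
  define k where "k = (i - 1) mod int n + 1"
  have k: "k \<in> {1..int n}" "[k = i] (mod int n)"
  proof -
    have "(i - 1) mod int n < int n" "0 \<le> (i - 1) mod int n"
      using n by simp_all
    then show "k \<in> {1..int n}"
      by (simp add: k_def)
    have "[(i - 1) mod int n + 1 = (i - 1) + 1] (mod int n)"
      by (intro cong_add) auto
    then show "[k = i] (mod int n)"
      by (simp add: k_def)
  qed
  have "excess n ?y < excess n x"
    unfolding excess_def
  proof (rule sum_strict_mono_ex1)
    show "\<forall>p\<in>{1..int n}. nat (last_col ?y p - p) \<le> nat (last_col x p - p)"
      using le by (simp add: nat_mono)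
    show "\<exists>p\<in>{1..int n}. nat (last_col ?y p - p) < nat (last_col x p - p)"
      using k less[OF k(2)] last_col_props(2)[OF y_uni y_band, of k] by (intro bexI[of _ k]) auto
  qed simp
  then show ?thesis
    using i(1) a_pos tnn_y by blast
qed

section \<open>Matrices of Laurent polynomials\<close>

text \<open>The bounds in the usual convolution formula depend on both factors. A fixed finite set
  containing the support of \<open>f\<close> gives all products in a matrix entry the same index
  set.\<close>

lemma fls_times_nth_finite:
  fixes f g :: "real fls"
  assumes "finite L" "\<And>l. l \<notin> L \<Longrightarrow> fls_nth f l = 0"
  shows "fls_nth (f * g) m = (\<Sum>l\<in>L. fls_nth f l * fls_nth g (m - l))"
proof -
  have "fls_nth (f * g) m =
      (\<Sum>l = fls_subdegree f..m - fls_subdegree g. fls_nth f l * fls_nth g (m - l))"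
    by (rule fls_times_nth(2))
  also have "\<dots> = (\<Sum>l\<in>L \<union> {fls_subdegree f..m - fls_subdegree g}. fls_nth f l * fls_nth g (m - l))"
  proof (intro sum.mono_neutral_left ballI)
    fix l assume "l \<in> L \<union> {fls_subdegree f..m - fls_subdegree g} - {fls_subdegree f..m - fls_subdegree g}"
    then have "l < fls_subdegree f \<or> m - l < fls_subdegree g"
      by auto
    then show "fls_nth f l * fls_nth g (m - l) = 0"
      by auto
  qed (use assms(1) in auto)
  also have "\<dots> = (\<Sum>l\<in>L. fls_nth f l * fls_nth g (m - l))"
    using assms by (intro sum.mono_neutral_right) auto
  finally show ?thesis .
qed

lemma laurent_polynomial_iff: "laurent_polynomial f \<longleftrightarrow> (\<exists>N. \<forall>k > N. fls_nth f k = 0)"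
proof
  assume "laurent_polynomial f"
  then have fin: "finite {k. fls_nth f k \<noteq> 0}"
    by (simp add: laurent_polynomial_def)
  have "fls_nth f k = 0" if "k > Max (insert 0 {k. fls_nth f k \<noteq> 0})" for k
    using Max_ge[of "insert 0 {k. fls_nth f k \<noteq> 0}" k] fin that by force
  then show "\<exists>N. \<forall>k > N. fls_nth f k = 0"
    by blast
next
  assume "\<exists>N. \<forall>k > N. fls_nth f k = 0"
  then obtain N where N: "\<And>k. k > N \<Longrightarrow> fls_nth f k = 0"
    by blast
  have "{k. fls_nth f k \<noteq> 0} \<subseteq> {fls_subdegree f..N}"
  proof
    fix k assume "k \<in> {k. fls_nth f k \<noteq> 0}"
    then have "\<not> N < k" "\<not> k < fls_subdegree f"
      using N[of k] by auto
    then show "k \<in> {fls_subdegree f..N}"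
      by simp
  qed
  then show "laurent_polynomial f"
    unfolding laurent_polynomial_def by (rule finite_subset) simp
qed

lemma strict_mono_on_Suc:
  "strict_mono_on {..<k} (c :: nat \<Rightarrow> int) \<Longrightarrow> strict_mono_on {..<k - 1} (\<lambda>a. c (Suc a))"
  using strict_mono_on_insert_index[of k c 0] by simp

text \<open>Compare the first row index with the first column index. If they differ, the first row
  or the first column of the submatrix is zero by monotonicity; if they agree, deleting both does
  not change the minor.\<close>

lemma tnn_id: "tnn id_unfolded"
  unfolding tnn_def
proof (intro allI impI)
  fix k and r c :: "nat \<Rightarrow> int"
  assume "strict_mono_on {..<k} r" "strict_mono_on {..<k} c"
  then show "0 \<le> finite_minor id_unfolded k r c"
  proof (induction k arbitrary: r c)
    case 0
    then show ?case
      by (simp add: finite_minor_def)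
  next
    case (Suc k)
    have r: "r 0 < r a" if "0 < a" "a < Suc k" for a
      using that by (intro strict_mono_onD[OF Suc.prems(1)]) auto
    have c: "c 0 < c a" if "0 < a" "a < Suc k" for a
      using that by (intro strict_mono_onD[OF Suc.prems(2)]) auto
    let ?M = "\<lambda>p q. id_unfolded (r p) (c q)"
    consider "r 0 < c 0" | "c 0 < r 0" | "r 0 = c 0"
      by linarith
    then show ?case
    proof cases
      case 1
      have "id_unfolded (r 0) (c q) = 0" if "q < Suc k" for q
        using c[of q] that 1 by (cases "q = 0") (auto simp: id_unfolded_def)
      then have "finite_minor id_unfolded (Suc k) r c = 0"
        unfolding finite_minor_array by (subst array_det_expand_row[of 0]) auto
      then show ?thesis
        by simp
    next
      case 2
      have "id_unfolded (r p) (c 0) = 0" if "p < Suc k" for p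
        using r[of p] that 2 by (cases "p = 0") (auto simp: id_unfolded_def)
      then have "finite_minor id_unfolded (Suc k) r c = 0"
        unfolding finite_minor_array by (intro array_det_zero_col[of 0]) auto
      then show ?thesis
        by simp
    next
      case 3
      have zero: "?M 0 q = 0" if "q \<in> {..<Suc k} - {0}" for q
        using c[of q] 3 that by (auto simp: id_unfolded_def)
      have "finite_minor id_unfolded (Suc k) r c = (\<Sum>q<Suc k. ?M 0 q * array_cof (Suc k) ?M 0 q)"
        unfolding finite_minor_array by (rule array_det_expand_row) simp
      also have "\<dots> = (\<Sum>q\<in>{0}. ?M 0 q * array_cof (Suc k) ?M 0 q)"
        using zero by (intro sum.mono_neutral_right) auto
      also have "\<dots> = finite_minor id_unfolded k (\<lambda>a. r (Suc a)) (\<lambda>b. c (Suc b))"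
        using 3 by (simp add: id_unfolded_def array_cof_def finite_minor_array)
      also have "\<dots> \<ge> 0"
        using Suc.prems by (intro Suc.IH) (auto dest: strict_mono_on_Suc)
      finally show ?thesis .
    qed
  qed
qed

lemma unitriangular_id: "unitriangular id_unfolded"
  by (simp add: unitriangular_def id_unfolded_def)

lemma banded_id: "banded id_unfolded"
  unfolding banded_def id_unfolded_def by (intro exI[of _ 0]) auto

context
  fixes n :: nat
  assumes n: "n \<ge> 2"
begin

section \<open>Laurent series matrices and their unfoldings\<close>

lemma unfold_periodic: "periodic_mat n (unfold_mat n A)"
proof -
  have "(p + int n - 1) mod int n = (p - 1) mod int n"
      "(p + int n - 1) div int n = (p - 1) div int n + 1" for p
    using n div_add_self2[of "int n" "p - 1"] mod_add_self2[of "p - 1"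
        "int n"] by (simp_all add: algebra_simps)
  then show ?thesis
    by (simp add: periodic_mat_def unfold_mat_def)
qed

lemma unfold_at:
  assumes "s < n"
  shows "unfold_mat n A p (int s + 1 + k * int n) =
    fls_nth (A $$ (nat ((p - 1) mod int n), s)) (k - (p - 1) div int n)"
  using assms by (simp add: unfold_mat_def)

lemma unfold_at_row:
  assumes "s < n"
  shows "unfold_mat n A (int s + 1 + k * int n) q =
    fls_nth (A $$ (s, nat ((q - 1) mod int n))) ((q - 1) div int n - k)"
  using assms by (simp add: unfold_mat_def)

lemma unfold_inject:
  assumes "A \<in> carrier_mat n n" "B \<in> carrier_mat n n" "unfold_mat n A = unfold_mat n B"
  shows "A = B"
proof (rule eq_matI)
  fix r s assume "r < dim_row B" "s < dim_col B"
  then have rs: "r < n" "s < n"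
    using assms by auto
  show "A $$ (r, s) = B $$ (r, s)"
  proof (rule fls_eqI)
    fix k
    have "fls_nth (C $$ (r, s)) k = unfold_mat n C (int r + 1) (int s + 1 + k * int n)" for C
      using rs by (simp add: unfold_at)
    then show "fls_nth (A $$ (r, s)) k = fls_nth (B $$ (r, s)) k"
      using assms(3) by simp
  qed
qed (use assms in auto)

lemma int_residue_cases:
  obtains s l where "s < n" "k = int s + 1 + l * int n"
proof
  show "nat ((k - 1) mod int n) < n"
    using n by (simp add: nat_less_iff)
  show "k = int (nat ((k - 1) mod int n)) + 1 + (k - 1) div int n * int n"
    using n by simp
qed

lemma laurent_polynomial_iff_banded:
  assumes A: "A \<in> carrier_mat n n"
  shows "(\<forall>f \<in> elements_mat A. laurent_polynomial f) \<longleftrightarrow> banded (unfold_mat n A)"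
proof
  assume pol: "\<forall>f \<in> elements_mat A. laurent_polynomial f"
  have "finite (elements_mat A)"
    by (simp add: elements_mat_def)
  then have "\<exists>N. \<forall>f \<in> elements_mat A. \<forall>k > N. fls_nth f k = 0"
    using pol
  proof induction
    case (insert f F)
    then obtain N N' where "\<forall>f \<in> F. \<forall>k > N. fls_nth f k = 0" "\<forall>k > N'. fls_nth f k = 0"
      by (auto simp: laurent_polynomial_iff)
    then show ?case
      by (intro exI[of _ "max N N'"]) auto
  qed simp
  then obtain N where N: "\<And>f k. f \<in> elements_mat A \<Longrightarrow> k > N \<Longrightarrow> fls_nth f k = 0"
    by blast
  \<comment> \<open>\<open>N\<close> bounds the exponents of all entries at once. The additional
    periods make up for the residues of \<open>p\<close> and \<open>q\<close>, so that the exponent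
    \<open>e - d\<close> exceeds \<open>N\<close>.\<close>
  have "unfold_mat n A p q = 0" if pq: "p + (\<bar>N\<bar> + 2) * int n < q" for p q
  proof -
    obtain r d where r: "r < n" "p = int r + 1 + d * int n"
      by (rule int_residue_cases)
    obtain s e where s: "s < n" "q = int s + 1 + e * int n"
      by (rule int_residue_cases)
    have "A $$ (r, s) \<in> elements_mat A"
      using A r s by auto
    have "(d + \<bar>N\<bar> + 2) * int n < (e + 1) * int n"
      using pq r s by (simp add: algebra_simps)
    then have "d + \<bar>N\<bar> + 2 < e + 1"
      using n by (simp add: mult_less_cancel_right)
    then have "e - d > N"
      by linarith
    moreover have "unfold_mat n A p q = fls_nth (A $$ (r, s)) (e - d)"
      using r s by (simp add: unfold_at)
    ultimately show ?thesis
      using N \<open>A $$ (r, s) \<in> elements_mat A\<close> by simp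
  qed
  then show "banded (unfold_mat n A)"
    unfolding banded_def by blast
next
  assume "banded (unfold_mat n A)"
  then obtain M where M: "\<And>p q. p + M < q \<Longrightarrow> unfold_mat n A p q = 0"
    by (auto simp: banded_def)
  show "\<forall>f \<in> elements_mat A. laurent_polynomial f"
  proof
    fix f assume "f \<in> elements_mat A"
    then obtain r s where rs: "r < n" "s < n" "f = A $$ (r, s)"
      using A by auto
    have "fls_nth f k = 0" if k: "k > \<bar>M\<bar> + int n" for k
    proof -
      have "\<bar>M\<bar> + int n < k * int n"
        using k n mult_left_mono[of 1 "int n" k] by linarith
      then have "int r + 1 + M < int s + 1 + k * int n"
        using rs by linarith
      then show ?thesis
        using M rs unfold_at[of s A "int r + 1" k] by simp
    qed
    then show "laurent_polynomial f"
      unfolding laurent_polynomial_iff by blast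
  qed
qed

text \<open>Used for the inverse matrix, of which only bandedness is known; the bound on the left
  comes from the entries being Laurent series.\<close>

lemma finite_support_row:
  assumes "A \<in> carrier_mat n n" "banded (unfold_mat n A)"
  shows "finite {k. unfold_mat n A p k \<noteq> 0}"
proof -
  define r where "r = nat ((p - 1) mod int n)"
  define d where "d = (p - 1) div int n"
  have r: "r < n"
    using n by (simp add: r_def nat_less_iff)
  have "finite {l. fls_nth (A $$ (r, s)) l \<noteq> 0}" if "s < n" for s
    using laurent_polynomial_iff_banded[OF assms(1)] assms r that
        by (auto simp: laurent_polynomial_def)
  then have "finite (\<Union>s<n. (\<lambda>l. int s + 1 + (l + d) * int n) ` {l. fls_nth (A $$ (r, s)) l \<noteq> 0})"
    by auto
  moreover have "{k. unfold_mat n A p k \<noteq> 0} \<subseteq>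
      (\<Union>s<n. (\<lambda>l. int s + 1 + (l + d) * int n) ` {l. fls_nth (A $$ (r, s)) l \<noteq> 0})"
  proof
    fix k assume k: "k \<in> {k. unfold_mat n A p k \<noteq> 0}"
    obtain s l where s: "s < n" "k = int s + 1 + l * int n"
      by (rule int_residue_cases)
    then have "fls_nth (A $$ (r, s)) (l - d) \<noteq> 0"
      using k by (simp add: unfold_at r_def d_def)
    then show "k \<in> (\<Union>s<n. (\<lambda>l. int s + 1 + (l + d) * int n) ` {l. fls_nth (A $$ (r, s)) l \<noteq> 0})"
      using s by (intro UN_I[of s] image_eqI[of _ _ "l - d"]) auto
  qed
  ultimately show ?thesis
    by (rule finite_subset[rotated])
qed

text \<open>A position in a row of the unfolding of \<open>A\<close> corresponds, via
  \<open>h\<close>, to a folded column and an exponent. Under this correspondence the convolutions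
  in an entry of \<open>A * B\<close> become an ordinary sum, which may be taken over any finite set
  containing the support of the row.\<close>

lemma unfold_times:
  assumes A: "A \<in> carrier_mat n n" and B: "B \<in> carrier_mat n n" and band: "banded (unfold_mat n A)"
    and K: "finite K" "\<And>k. k \<notin> K \<Longrightarrow> unfold_mat n A p k = 0"
  shows "unfold_mat n (A * B) p q = (\<Sum>k\<in>K. unfold_mat n A p k * unfold_mat n B k q)"
proof -
  let ?F = "\<lambda>k. unfold_mat n A p k * unfold_mat n B k q"
  obtain r d where r: "r < n" "p = int r + 1 + d * int n"
    by (rule int_residue_cases)
  obtain c e where c: "c < n" "q = int c + 1 + e * int n"
    by (rule int_residue_cases)
  define L where "L = (\<Union>s<n. {l. fls_nth (A $$ (r, s)) l \<noteq> 0})"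
  have pol: "laurent_polynomial (A $$ (r, s))" if "s < n" for s
    using laurent_polynomial_iff_banded[OF A] band A r that by auto
  have L: "finite L" "\<And>s l. s < n \<Longrightarrow> l \<notin> L \<Longrightarrow> fls_nth (A $$ (r, s)) l = 0"
    using pol by (auto simp: L_def laurent_polynomial_def)
  define h where "h = (\<lambda>(s, l). int s + 1 + (l + d) * int n)"
  have inj: "inj_on h ({..<n} \<times> L)"
  proof (rule inj_onI)
    fix u v assume uv: "u \<in> {..<n} \<times> L" "v \<in> {..<n} \<times> L" "h u = h v"
    obtain s l s' l' where *: "u = (s, l)" "v = (s', l')"
      by (metis surj_pair)
    have eq: "int s + (l + d) * int n = int s' + (l' + d) * int n" "s < n" "s' < n"
      using uv * by (auto simp: h_def)
    have "s = s'"
      using arg_cong[OF eq(1), of "\<lambda>z. z mod int n"] eq(2,3) by simp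
    then show "u = v"
      using eq n * by simp
  qed
  have "unfold_mat n (A * B) p q = fls_nth ((A * B) $$ (r, c)) (e - d)"
    using r c by (simp add: unfold_at)
  also have "(A * B) $$ (r, c) = (\<Sum>s<n. A $$ (r, s) * B $$ (s, c))"
    using A B r c by (simp add: scalar_prod_def lessThan_atLeast0)
  also have "fls_nth \<dots> (e - d) = (\<Sum>s<n. fls_nth (A $$ (r, s) * B $$ (s, c)) (e - d))"
    by (induction n) simp_all
  also have "\<dots> = (\<Sum>s<n. \<Sum>l\<in>L. fls_nth (A $$ (r, s)) l * fls_nth (B $$ (s, c)) (e - d - l))"
    using L by (intro sum.cong fls_times_nth_finite) auto
  also have "\<dots> = (\<Sum>s<n. \<Sum>l\<in>L. ?F (h (s, l)))"
  proof (intro sum.cong refl)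
    fix s l assume "s \<in> {..<n}"
    then have s: "s < n"
      by simp
    have "(p - 1) mod int n = int r" "(p - 1) div int n = d"
      "(q - 1) mod int n = int c" "(q - 1) div int n = e"
      using r c by simp_all
    then show "fls_nth (A $$ (r, s)) l * fls_nth (B $$ (s, c)) (e - d - l) = ?F (h (s, l))"
      unfolding h_def prod.case unfold_at[OF s] unfold_at_row[OF s]
      by (simp add: diff_diff_eq add.commute)
  qed
  also have "\<dots> = (\<Sum>u\<in>{..<n} \<times> L. ?F (h u))"
    by (simp add: sum.cartesian_product)
  also have "\<dots> = (\<Sum>k\<in>h ` ({..<n} \<times> L). ?F k)"
    using inj by (simp add: sum.reindex)
  also have "\<dots> = (\<Sum>k\<in>h ` ({..<n} \<times> L) \<union> K. ?F k)"
  proof (intro sum.mono_neutral_left ballI)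
    fix k assume k: "k \<in> h ` ({..<n} \<times> L) \<union> K - h ` ({..<n} \<times> L)"
    obtain s l where s: "s < n" "k = int s + 1 + l * int n"
      by (rule int_residue_cases)
    have "k = h (s, l - d)"
      using s by (simp add: h_def)
    then have "l - d \<notin> L"
      using k s by auto
    then show "?F k = 0"
      using L(2) r s by (simp add: unfold_at)
  qed (use L K in auto)
  also have "\<dots> = (\<Sum>k\<in>K. ?F k)"
    using L K by (intro sum.mono_neutral_right) auto
  finally show ?thesis .
qed

lemma unfold_one: "unfold_mat n (1\<^sub>m n) = id_unfolded"
proof (intro ext)
  fix p q
  obtain r d where r: "r < n" "p = int r + 1 + d * int n"
    by (rule int_residue_cases)
  obtain s e where s: "s < n" "q = int s + 1 + e * int n"
    by (rule int_residue_cases)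
  have "p = q \<longleftrightarrow> r = s \<and> d = e"
  proof
    assume "p = q"
    then have eq: "int r + d * int n = int s + e * int n"
      using r s by simp
    have "r = s"
      using arg_cong[OF eq, of "\<lambda>z. z mod int n"] r(1) s(1) by simp
    then show "r = s \<and> d = e"
      using eq n by simp
  qed (use r s in simp)
  then show "unfold_mat n (1\<^sub>m n) p q = id_unfolded p q"
    using r s by (simp add: unfold_at id_unfolded_def)
qed

section \<open>Multiplication by a generator and the polynomial inverse\<close>

lemma chevalley_carrier: "chevalley n i a \<in> carrier_mat n n"
  by (simp add: chevalley_def fold_mat_def)

lemma banded_chevalley: "banded (unfold_mat n (chevalley n i a))"
  unfolding banded_def unfold_chevalley[OF n]
  by (intro exI[of _ 1]) (auto simp: chevalley_unfolded_def)

lemma unfold_chevalley_times: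
  assumes "A \<in> carrier_mat n n"
  shows "unfold_mat n (chevalley n i a * A) = chev n i a (unfold_mat n A)"
proof (intro ext)
  fix p q
  have "unfold_mat n (chevalley n i a * A) p q =
      (\<Sum>k\<in>{p, p + 1}. unfold_mat n (chevalley n i a) p k * unfold_mat n A k q)"
    by (rule unfold_times[OF chevalley_carrier assms banded_chevalley])
      (auto simp: unfold_chevalley[OF n] chevalley_unfolded_def)
  then show "unfold_mat n (chevalley n i a * A) p q = chev n i a (unfold_mat n A) p q"
    by (simp add: unfold_chevalley[OF n] chevalley_unfolded_def row_add_def)
qed

lemma chevalley_times_neg: "chevalley n i a * chevalley n i (- a) = 1\<^sub>m n"
proof (rule unfold_inject)
  have "chevalley n i b = chevalley n i b * 1\<^sub>m n" for b
    using right_mult_one_mat[OF chevalley_carrier] by simp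
  then have "unfold_mat n (chevalley n i (- a)) = chev n i (- a) id_unfolded"
    using unfold_chevalley_times[of "1\<^sub>m n" i "- a"] by (simp add: unfold_one)
  then show "unfold_mat n (chevalley n i a * chevalley n i (- a)) = unfold_mat n (1\<^sub>m n)"
    by (simp add: unfold_chevalley_times[OF chevalley_carrier] unfold_one chev_add[OF n])
      (simp add: row_add_def fun_eq_iff)
qed (use chevalley_carrier in \<open>auto intro: mult_carrier_mat\<close>)

lemma banded_times_chevalley:
  assumes B: "B \<in> carrier_mat n n" and band: "banded (unfold_mat n B)"
  shows "banded (unfold_mat n (B * chevalley n i a))"
proof -
  obtain M where M: "\<And>p q. p + M < q \<Longrightarrow> unfold_mat n B p q = 0"
    using band by (auto simp: banded_def)
  have "unfold_mat n (B * chevalley n i a) p q = 0" if "p + (M + 1) < q" for p q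
  proof -
    have "unfold_mat n (B * chevalley n i a) p q =
        (\<Sum>k\<in>{k. unfold_mat n B p k \<noteq> 0}. unfold_mat n B p k * unfold_mat n (chevalley n i a) k q)"
      by (rule unfold_times[OF B chevalley_carrier band finite_support_row[OF B band]]) simp
    also have "\<dots> = 0"
    proof (intro sum.neutral ballI)
      fix k
      show "unfold_mat n B p k * unfold_mat n (chevalley n i a) k q = 0"
        using M[of p k] that by (auto simp: unfold_chevalley[OF n] chevalley_unfolded_def)
    qed
    finally show ?thesis .
  qed
  then show ?thesis
    unfolding banded_def by blast
qed

lemma loop_U_nonneg_pol_iff:
  "A \<in> loop_U_nonneg_pol n \<longleftrightarrow> A \<in> carrier_mat n n \<and> unitriangular (unfold_mat n A) \<and>
     tnn (unfold_mat n A) \<and> banded (unfold_mat n A) \<and>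
     (\<exists>B \<in> carrier_mat n n. A * B = 1\<^sub>m n \<and> B * A = 1\<^sub>m n \<and> banded (unfold_mat n B))"
  (is "_ \<longleftrightarrow> ?R")
proof
  assume A: "A \<in> loop_U_nonneg_pol n"
  then have carrier: "A \<in> carrier_mat n n"
    by (auto simp: loop_U_nonneg_pol_def loop_U_nonneg_def loop_U_def loop_GL_def)
  obtain B where B: "inverts_mat A B" "inverts_mat B A" "\<forall>f \<in> elements_mat B. laurent_polynomial f"
    using A by (auto simp: loop_U_nonneg_pol_def)
  have AB: "A * B = 1\<^sub>m n" and BA: "B * A = 1\<^sub>m (dim_row B)"
    using B carrier by (auto simp: inverts_mat_def)
  \<comment> \<open>\<open>inverts_mat\<close> does not fix the size of \<open>B\<close>; the two
    products do.\<close>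
  have "dim_col B = n" "dim_row B = n"
    using arg_cong[OF AB, of dim_col] arg_cong[OF BA, of dim_col] carrier by auto
  then have "B \<in> carrier_mat n n"
    by auto
  then show ?R
    using A carrier AB BA B(3) laurent_polynomial_iff_banded
    by (auto simp: loop_U_nonneg_pol_def loop_U_nonneg_def loop_U_def unitriangular_def tnn_def)
next
  assume R: ?R
  then obtain B where B: "B \<in> carrier_mat n n" "A * B = 1\<^sub>m n" "B * A = 1\<^sub>m n"
      "banded (unfold_mat n B)"
    by blast
  have "inverts_mat A B" "inverts_mat B A"
    using R B by (auto simp: inverts_mat_def)
  moreover have "square_mat A"
    using R by auto
  moreover have "\<forall>f \<in> elements_mat B. laurent_polynomial f"
    using laurent_polynomial_iff_banded B by blast
  ultimately show "A \<in> loop_U_nonneg_pol n"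
    using R laurent_polynomial_iff_banded[of A]
    unfolding loop_U_nonneg_pol_def loop_U_nonneg_def loop_U_def loop_GL_def invertible_mat_def
      unitriangular_def tnn_def by blast
qed

text \<open>If \<open>B\<close> inverts \<open>A\<close>, then
  \<open>B * chevalley n i (- a)\<close> inverts the product and is banded again. Only total
  nonnegativity has to be supplied, for either sign of \<open>a\<close>.\<close>

lemma chevalley_times_pol:
  assumes "A \<in> loop_U_nonneg_pol n" "tnn (chev n i a (unfold_mat n A))"
  shows "chevalley n i a * A \<in> loop_U_nonneg_pol n"
proof -
  let ?C = "chevalley n i a" and ?D = "chevalley n i (- a)"
  note C = chevalley_carrier[of i a] and D = chevalley_carrier[of i "- a"]
  have A: "A \<in> carrier_mat n n" "unitriangular (unfold_mat n A)" "banded (unfold_mat n A)"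
    using assms(1) by (auto simp: loop_U_nonneg_pol_iff)
  obtain B where B: "B \<in> carrier_mat n n" "A * B = 1\<^sub>m n" "B * A = 1\<^sub>m n" "banded (unfold_mat n B)"
    using assms(1) by (auto simp: loop_U_nonneg_pol_iff)
  have "?C * A * (B * ?D) = ?C * (A * (B * ?D))"
    using A B C D by (intro assoc_mult_mat) auto
  also have "A * (B * ?D) = A * B * ?D"
    using A B D by (intro assoc_mult_mat[symmetric]) auto
  finally have CD: "?C * A * (B * ?D) = 1\<^sub>m n"
    using B D by (simp add: chevalley_times_neg)
  have "B * ?D * (?C * A) = B * (?D * (?C * A))"
    using A B C D by (intro assoc_mult_mat) auto
  also have "?D * (?C * A) = ?D * ?C * A"
    using A C D by (intro assoc_mult_mat[symmetric]) auto
  finally have DC: "B * ?D * (?C * A) = 1\<^sub>m n"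
    using A B chevalley_times_neg[of i "- a"] by simp
  have "B * ?D \<in> carrier_mat n n" "?C * A \<in> carrier_mat n n"
    using A B C D by auto
  then show ?thesis
    using assms(2) A CD DC banded_times_chevalley[OF B(1,4)]
    unfolding loop_U_nonneg_pol_iff unfold_chevalley_times[OF A(1)]
    by (auto intro: unitriangular_row_add banded_row_add)
qed

text \<open>The outermost entries in row 0 of the inverse \<open>B\<close> cannot be cancelled in
  \<open>B * A\<close>: only the last one contributes to column \<open>Max K + c\<close>, only the
  first one to column \<open>Min K\<close>. As the product is the identity, both columns are 0, so
  \<open>c = - Max K \<le> - Min K = 0\<close>.\<close>

lemma pol_rigid:
  assumes "A \<in> loop_U_nonneg_pol n"
    and nz: "\<And>p. unfold_mat n A p (p + c) \<noteq> 0" and zero: "\<And>p q. p + c < q \<Longrightarrow> unfold_mat n A p q = 0"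
  shows "c \<le> 0"
proof -
  have A: "A \<in> carrier_mat n n" "unitriangular (unfold_mat n A)"
    using assms(1) by (auto simp: loop_U_nonneg_pol_iff)
  obtain B where B: "B \<in> carrier_mat n n" "B * A = 1\<^sub>m n" "banded (unfold_mat n B)"
    using assms(1) by (auto simp: loop_U_nonneg_pol_iff)
  let ?x = "unfold_mat n A" and ?y = "unfold_mat n B"
  define K where "K = {k. ?y 0 k \<noteq> 0}"
  have K: "finite K" "\<And>k. k \<notin> K \<Longrightarrow> ?y 0 k = 0"
    using finite_support_row[OF B(1,3)] by (auto simp: K_def)
  have prod: "(\<Sum>k\<in>K. ?y 0 k * ?x k q) = id_unfolded 0 q" for q
    using unfold_times[OF B(1) A(1) B(3) K, of q] B(2) by (simp add: unfold_one)
  have "K \<noteq> {}"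
    using prod[of 0] by (auto simp: id_unfolded_def)
  have single: "q = 0" if "k0 \<in> K" "?x k0 q \<noteq> 0" "\<And>k. k \<in> K \<Longrightarrow> k \<noteq> k0 \<Longrightarrow> ?x k q = 0" for k0 q
  proof -
    have "(\<Sum>k\<in>K. ?y 0 k * ?x k q) = (\<Sum>k\<in>{k0}. ?y 0 k * ?x k q)"
      using K(1) that by (intro sum.mono_neutral_right) auto
    then have "id_unfolded 0 q = ?y 0 k0 * ?x k0 q"
      using prod[of q] by simp
    then have "id_unfolded 0 q \<noteq> 0"
      using that(1,2) by (simp add: K_def)
    then show ?thesis
      by (auto simp: id_unfolded_def)
  qed
  have "Max K + c = 0"
  proof (rule single)
    show "Max K \<in> K" using K \<open>K \<noteq> {}\<close> by simp
    show "?x k (Max K + c) = 0" if "k \<in> K" "k \<noteq> Max K" for k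
      using that K(1) by (intro zero) (simp add: order_less_le)
  qed (rule nz)
  moreover have "Min K = 0"
  proof (rule single)
    show "Min K \<in> K" using K \<open>K \<noteq> {}\<close> by simp
    show "?x k (Min K) = 0" if "k \<in> K" "k \<noteq> Min K" for k
    proof -
      have "Min K < k" using that K(1) by (simp add: order_less_le)
      then show ?thesis using A(2) by (simp add: unitriangular_def)
    qed
    show "?x (Min K) (Min K) \<noteq> 0" using A(2) by (simp add: unitriangular_def)
  qed
  moreover have "Min K \<le> Max K"
    using K(1) \<open>K \<noteq> {}\<close> by simp
  ultimately show ?thesis
    by simp
qed

section \<open>Cells of matrices and cells of unfoldings\<close>

lemma E_word_Nil: "E_word n [] = {1\<^sub>m n}"
  by (simp add: E_word_def chevalley_prod_def)

lemma E_word_Cons: "E_word n (i # ws) = {chevalley n i a * A | a A. 0 < a \<and> A \<in> E_word n ws}"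
proof (intro equalityI subsetI)
  fix X assume "X \<in> E_word n (i # ws)"
  then obtain as where as: "X = chevalley_prod n (i # ws) as" "length as = Suc (length ws)"
      "\<forall>a\<in>set as. 0 < a"
    by (auto simp: E_word_def)
  then obtain a bs where "as = a # bs"
    by (cases as) auto
  then show "X \<in> {chevalley n i a * A | a A. 0 < a \<and> A \<in> E_word n ws}"
    using as by (auto simp: E_word_def chevalley_prod_def)
next
  fix X assume "X \<in> {chevalley n i a * A | a A. 0 < a \<and> A \<in> E_word n ws}"
  then obtain a bs where "X = chevalley n i a * chevalley_prod n ws bs" "0 < a"
      "length bs = length ws" "\<forall>b\<in>set bs. 0 < b"
    by (auto simp: E_word_def)
  then show "X \<in> E_word n (i # ws)"
    unfolding E_word_def by (auto simp: chevalley_prod_def intro!: exI[of _ "a # bs"])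
qed

lemma E_word_iff_cell: "A \<in> E_word n ws \<longleftrightarrow> A \<in> carrier_mat n n \<and> unfold_mat n A \<in> cell n ws"
proof (induction ws arbitrary: A)
  case Nil
  then show ?case
    using unfold_inject[of A "1\<^sub>m n"] by (auto simp: E_word_Nil unfold_one)
next
  case (Cons i ws)
  show ?case
  proof
    assume "A \<in> E_word n (i # ws)"
    then obtain a A' where "A = chevalley n i a * A'" "0 < a" "A' \<in> E_word n ws"
      by (auto simp: E_word_Cons)
    then show "A \<in> carrier_mat n n \<and> unfold_mat n A \<in> cell n (i # ws)"
      using Cons.IH by (auto
          simp: unfold_chevalley_times intro!: mult_carrier_mat chevalley_carrier)
  next
    assume A: "A \<in> carrier_mat n n \<and> unfold_mat n A \<in> cell n (i # ws)"
    then obtain a x where x: "unfold_mat n A = chev n i a x" "0 < a" "x \<in> cell n ws"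
      by auto
    let ?A' = "chevalley n i (- a) * A"
    have A': "?A' \<in> carrier_mat n n"
      using A by (auto intro: mult_carrier_mat chevalley_carrier)
    have "chev n i (- a) (chev n i a x) = x"
      by (simp add: chev_add[OF n] row_add_def fun_eq_iff)
    then have "unfold_mat n ?A' = x"
      using A x(1) by (simp add: unfold_chevalley_times)
    then have "?A' \<in> E_word n ws" "A = chevalley n i a * ?A'"
      using Cons.IH x A' A
      by (auto intro!: unfold_inject mult_carrier_mat[OF chevalley_carrier]
          simp: unfold_chevalley_times)
    then show "A \<in> E_word n (i # ws)"
      using x(2) unfolding E_word_Cons by blast
  qed
qed

lemma E_word_subset_pol: "E_word n ws \<subseteq> loop_U_nonneg_pol n"
proof (induction ws)
  case Nil
  have "1\<^sub>m n * 1\<^sub>m n = (1\<^sub>m n :: real fls mat)"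
    by simp
  then show ?case
    unfolding E_word_Nil singleton_insert_inj_eq
    by (auto simp: loop_U_nonneg_pol_iff unfold_one unitriangular_id tnn_id banded_id intro!: bexI[of _ "1\<^sub>m n"])
next
  case (Cons i ws)
  show ?case
  proof
    fix X assume "X \<in> E_word n (i # ws)"
    then obtain a A where X: "X = chevalley n i a * A" "0 < a" "A \<in> loop_U_nonneg_pol n"
      using Cons.IH by (auto simp: E_word_Cons)
    then have "tnn (chev n i a (unfold_mat n A))"
      using not_cong_Suc[OF n] by (intro tnn_row_add) (auto simp: loop_U_nonneg_pol_iff)
    then show "X \<in> loop_U_nonneg_pol n"
      using X chevalley_times_pol by simp
  qed
qed

lemma pol_subset_E_word:
  assumes "A \<in> loop_U_nonneg_pol n"
  shows "\<exists>ws \<in> words n. A \<in> E_word n ws"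
  using assms
proof (induction "excess n (unfold_mat n A)" arbitrary: A rule: less_induct)
  case less
  have A: "A \<in> carrier_mat n n"
    using less.prems by (simp add: loop_U_nonneg_pol_iff)
  show ?case
  proof (cases "unfold_mat n A = id_unfolded")
    case True
    then have "A \<in> E_word n []"
      using A by (simp add: E_word_iff_cell)
    then show ?thesis
      by (intro bexI[of _ "[]"]) (auto simp: words_def)
  next
    case False
    have "\<exists>i a. i \<in> {0..<int n} \<and> 0 < a \<and> tnn (chev n i (- a) (unfold_mat n A)) \<and>
        excess n (chev n i (- a) (unfold_mat n A)) < excess n (unfold_mat n A)"
      using less.prems False n pol_rigid[OF less.prems] unfold_periodic
      by (intro factor_chev) (auto simp: loop_U_nonneg_pol_iff)
    then obtain i a where i: "i \<in> {0..<int n}" "0 < a" "tnn (chev n i (- a) (unfold_mat n A))"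
        "excess n (chev n i (- a) (unfold_mat n A)) < excess n (unfold_mat n A)"
      by blast
    let ?A = "chevalley n i (- a) * A"
    have "?A \<in> loop_U_nonneg_pol n"
      using less.prems i(3) by (rule chevalley_times_pol)
    then obtain ws where ws: "ws \<in> words n" "?A \<in> E_word n ws"
      using less.hyps[of ?A] i(4) A by (auto simp: unfold_chevalley_times)
    have "chevalley n i a * ?A = chevalley n i a * chevalley n i (- a) * A"
      by (rule assoc_mult_mat[OF chevalley_carrier chevalley_carrier A, symmetric])
    then have "A = chevalley n i a * ?A"
      using A by (simp add: chevalley_times_neg)
    then have "A \<in> E_word n (i # ws)"
      using ws i(2) unfolding E_word_Cons by blast
    then show ?thesis
      using ws i(1) by (intro bexI[of _ "i # ws"]) (auto simp: words_def)
  qed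
qed

lemma E_cell_eq:
  assumes "reduced_word n w ws"
  shows "E_cell n w = E_word n ws"
proof -
  have "reduced_word n w (SOME ws. reduced_word n w ws)"
    using assms by (rule someI)
  then show ?thesis
    unfolding E_cell_def using cell_reduced_eq[OF n _ assms] by (auto simp: E_word_iff_cell)
qed

end

theorem theorem3p2:
  fixes n :: nat
  assumes "n \<ge> 2"
  shows "loop_U_nonneg_pol n = (\<Union>w \<in> affine_sym n. E_cell n w) \<and>
         disjoint_family_on (E_cell n) (affine_sym n)"
proof (intro conjI equalityI subsetI)
  fix A assume "A \<in> loop_U_nonneg_pol n"
  then obtain ws where "ws \<in> words n" "A \<in> E_word n ws"
    using pol_subset_E_word[OF assms] by blast
  \<comment> \<open>The word of the factorization need not be reduced;
    \<open>ex_reduced_cell\<close> replaces it by a reduced one, whose permutation may differ from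
    that of \<open>ws\<close>.\<close>
  then obtain w ws' where red: "reduced_word n w ws'" "unfold_mat n A \<in> cell n ws'"
      "A \<in> carrier_mat n n"
    using ex_reduced_cell[OF assms, of ws "unfold_mat n A"]
        unfolding E_word_iff_cell[OF assms] by blast
  then have "A \<in> E_cell n w"
    by (simp add: E_cell_eq[OF assms] E_word_iff_cell[OF assms])
  then show "A \<in> (\<Union>w \<in> affine_sym n. E_cell n w)"
    using reduced_word_mem[OF assms red(1)] by blast
next
  fix A assume "A \<in> (\<Union>w \<in> affine_sym n. E_cell n w)"
  then show "A \<in> loop_U_nonneg_pol n"
    \<comment> \<open>\<open>E_word_subset_pol\<close> covers every word, in particular the one
      chosen in \<open>E_cell\<close>.\<close>
    using E_word_subset_pol[OF assms] by (auto simp: E_cell_def)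
next
  show "disjoint_family_on (E_cell n) (affine_sym n)"
    unfolding disjoint_family_on_def
  proof (intro ballI impI equals0I)
    fix w w' A assume w: "w \<in> affine_sym n" "w' \<in> affine_sym n" "w \<noteq> w'"
      and A: "A \<in> E_cell n w \<inter> E_cell n w'"
    obtain ws ws' where "reduced_word n w ws" "reduced_word n w' ws'"
      using ex_reduced_word[OF assms] w by blast
    then show False
      using A w(3) cell_disjoint[OF assms]
      by (auto simp: E_cell_eq[OF assms] E_word_iff_cell[OF assms])
  qed
qed

end
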